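(* Let $\mathbb{E}$ be a real spectrum and $V\in RO(\mathbb{Z}/(2))$. Let $\partial:\mathbb{E}_{V-1}\to\mathbb{E}_{V-\alpha}$ be the composite of the connecting map $\mathbb{E}_{V-1}\to\mathbb{E}\mathbb{R}_{V-\alpha}$, obtained by looping back the fibration $\mathbb{E}\mathbb{R}_{V-\alpha}\xrightarrow{a}\mathbb{E}\mathbb{R}_V\xrightarrow{\iota}\mathbb{E}_V$, with the inclusion of homotopy fixed points $\mathbb{E}\mathbb{R}_{V-\alpha}\to\mathbb{E}_{V-\alpha}$. Identify $\mathbb{E}_{V-1}=\Omega\mathbb{E}_V$ with $\mathbb{E}_{V-\alpha}=\Omega^\alpha\mathbb{E}_V$ as (non-equivariant) spaces. Then, under this identification, the map $\partial$ is given by $$\partial=\mathrm{Id}-\sigma=\mathrm{Id}+\tilde\sigma,$$ where $\sigma$ denotes the action of the generator of $\mathbb{Z}/(2)$ on $\mathbb{E}_{V-1}$ and $\tilde\sigma$ its action on $\mathbb{E}_{V-\alpha}$.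
   Context: Real spectra. $RO(\mathbb{Z}/(2))=\mathbb{Z}\oplus\mathbb{Z}\alpha$, where $\alpha$ is the one-dimensional sign representation. For a representation $U$, $S^U$ is its one-point compactification, and for a pointed $\mathbb{Z}/(2)$-space $X$, $\Omega^U X=\mathrm{Map}_*(S^U,X)$ with the conjugation (diagonal) action. A real spectrum $\mathbb{E}$ is a collection of pointed $\mathbb{Z}/(2)$-spaces $\mathbb{E}_V$, $V\in RO(\mathbb{Z}/(2))$, with a compatible family of equivariant homeomorphisms $\Omega^U\mathbb{E}_{U\oplus V}\to\mathbb{E}_V$ (i.e. a genuine $\mathbb{Z}/(2)$-equivariant $\Omega$-spectrum graded on $RO(\mathbb{Z}/(2))$). $\mathbb{E}\mathbb{R}_V$ denotes the homotopy fixed points of the $\mathbb{Z}/(2)$-action on $\mathbb{E}_V$; for fixed $V$ the collections $\{\mathbb{E}_{k+V}\}_{k\in\mathbb{Z}}$ and $\{\mathbb{E}\mathbb{R}_{k+V}\}_{k\in\mathbb{Z}}$ are ordinary spectra, also denoted $\mathbb{E}_V$ and $\mathbb{E}\mathbb{R}_V$. The fibration. The inclusion of the poles $a:S^0\to S^\alpha$ fits in an equivariant cofibration $\mathbb{Z}/(2)^+\to S^0\xrightarrow{a}S^\alpha\xrightarrow{p}\mathbb{Z}/(2)^+\wedge S^1$ with $p$ the pinch map. Smashing $\mathbb{E}_V$ with its Spanier--Whitehead dual $S^{-\alpha}\xrightarrow{a}S^0\to\mathbb{Z}/(2)^+$, taking homotopy fixed points, and identifying $(\mathbb{E}_V\wedge\mathbb{Z}/(2)^+)^{h\mathbb{Z}/(2)}$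 with $\mathbb{E}_V$ via $x\mapsto(x,\sigma(x))$ (where $\mathbb{E}_V\wedge\mathbb{Z}/(2)^+\simeq\mathbb{E}_V\times\mathbb{E}_V$ with action $(x,y)\mapsto(\sigma(y),\sigma(x))$) gives the fibration $\mathbb{E}\mathbb{R}_{V-\alpha}\xrightarrow{a}\mathbb{E}\mathbb{R}_V\xrightarrow{\iota}\mathbb{E}_V$, where $\iota$ is the standard inclusion of homotopy fixed points. The connecting map $\mathbb{E}_{V-1}\to\mathbb{E}\mathbb{R}_{V-\alpha}$ is the one induced by the dual of $p$, a map $\mathbb{Z}/(2)^+\wedge S^{-1}\to S^{-\alpha}$, with the sign convention that non-equivariantly this dual is the difference map $(x,y)\mapsto x-y$ (under $S^{-1}=S^{-\alpha}$). The actions. Non-equivariantly $S^1=S^\alpha$, so $\Omega\mathbb{E}_V=\Omega^\alpha\mathbb{E}_V$ as spaces, but the $\mathbb{Z}/(2)$-actions differ: $\tilde\sigma=\sigma\alpha_*=-\sigma$, where $\alpha_*$ is precomposition with the sign involution on the loop coordinate (homotopic to loop inversion). Sums, differences and equalities of maps are understood up to homotopy, using the infinite loop structure. *)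

theory Defs
  imports "HOL-Analysis.Analysis"
begin

section \<open>Pointed \<open>Z/2\<close>-spaces and mapping spaces\<close>

text \<open>\<open>gact\<close> is the action of the generator of \<open>Z/2\<close>.\<close>

record 'a gspace =
  gtop :: "'a topology"
  gbase :: 'a
  gact :: "'a \<Rightarrow> 'a"

definition pointed_gspace :: "'a gspace \<Rightarrow> bool" where
  "pointed_gspace X \<longleftrightarrow>
     gbase X \<in> topspace (gtop X) \<and>
     continuous_map (gtop X) (gtop X) (gact X) \<and>
     (\<forall>x\<in>topspace (gtop X). gact X (gact X x) = x) \<and>
     gact X (gbase X) = gbase X"

definition pointed_ghomeo :: "'a gspace \<Rightarrow> 'b gspace \<Rightarrow> ('a \<Rightarrow> 'b) \<Rightarrow> bool" where
  "pointed_ghomeo X Y h \<longleftrightarrow>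
     homeomorphic_map (gtop X) (gtop Y) h \<and>
     h (gbase X) = gbase Y \<and>
     (\<forall>x\<in>topspace (gtop X). h (gact X x) = gact Y (h x))"

text \<open>Points of a mapping space are continuous maps made \<open>extensional\<close>, so that a map
  on \<open>topspace X\<close> is represented by exactly one HOL function.  The topology is the
  compact-open one.\<close>

definition map_carrier :: "'a topology \<Rightarrow> 'b topology \<Rightarrow> ('a \<Rightarrow> 'b) set" where
  "map_carrier X Y = {f \<in> extensional (topspace X). continuous_map X Y f}"

definition map_top :: "'a topology \<Rightarrow> 'b topology \<Rightarrow> ('a \<Rightarrow> 'b) topology" where
  "map_top X Y = topology_generated_by
     {{f \<in> map_carrier X Y. f ` K \<subseteq> U} | K U. compactin X K \<and> openin Y U}"

lemma topspace_map_top [simp]: "topspace (map_top X Y) = map_carrier X Y"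
proof -
  have "map_carrier X Y = {f \<in> map_carrier X Y. f ` {} \<subseteq> {}}" by simp
  then have "map_carrier X Y \<in>
      {{f \<in> map_carrier X Y. f ` K \<subseteq> U} | K U. compactin X K \<and> openin Y U}"
    using compactin_empty openin_empty by blast
  then show ?thesis
    unfolding map_top_def topology_generated_by_topspace by blast
qed

text \<open>\<open>Map\<^sub>*(A, X)\<close> with the conjugation action.  The generator is an involution, so
  conjugation by it needs no inverse.\<close>

definition gmap :: "'a gspace \<Rightarrow> 'b gspace \<Rightarrow> ('a \<Rightarrow> 'b) gspace" where
  "gmap A X = \<lparr>
     gtop = subtopology (map_top (gtop A) (gtop X)) {f. f (gbase A) = gbase X},
     gbase = restrict (\<lambda>_. gbase X) (topspace (gtop A)),
     gact = (\<lambda>f. restrict (\<lambda>s. gact X (f (gact A s))) (topspace (gtop A)))\<rparr>"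

definition precomp :: "'a gspace \<Rightarrow> ('a \<Rightarrow> 'b) \<Rightarrow> ('b \<Rightarrow> 'c) \<Rightarrow> ('a \<Rightarrow> 'c)" where
  "precomp A p f = restrict (f \<circ> p) (topspace (gtop A))"

section \<open>Representation spheres\<close>

text \<open>The pair \<open>(m, n)\<close> stands for \<open>m + n\<alpha>\<close>: a natural pair for an actual
  representation, an integer pair for an element of \<open>RO(Z/2)\<close>.  Vectors of
  \<open>m + n\<alpha>\<close> are pairs of sequences, the first supported on the first \<open>m\<close> places and
  the second on the first \<open>n\<close>; the point at infinity of the one-point compactification
  is \<open>None\<close>.\<close>

type_synonym vec = "(nat \<Rightarrow> real) \<times> (nat \<Rightarrow> real)"
type_synonym rep = "nat \<times> nat"
type_synonym ro = "int \<times> int"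

abbreviation rep_one :: rep where "rep_one \<equiv> (1, 0)"
abbreviation rep_alpha :: rep where "rep_alpha \<equiv> (0, 1)"

definition ro_of :: "rep \<Rightarrow> ro" where
  "ro_of U = (int (fst U), int (snd U))"

definition rep_sphere :: "rep \<Rightarrow> vec option gspace" where
  "rep_sphere U = \<lparr>
     gtop = Alexandroff_compactification
              (prod_topology (Euclidean_space (fst U)) (Euclidean_space (snd U))),
     gbase = None,
     gact = map_option (\<lambda>(x, y). (x, \<lambda>i. - y i))\<rparr>"

definition loops :: "rep \<Rightarrow> 'a gspace \<Rightarrow> (vec option \<Rightarrow> 'a) gspace" where
  "loops U X = gmap (rep_sphere U) X"

definition append_coords :: "nat \<Rightarrow> (nat \<Rightarrow> real) \<Rightarrow> (nat \<Rightarrow> real) \<Rightarrow> nat \<Rightarrow> real" where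
  "append_coords k x x' = (\<lambda>i. if i < k then x i else x' (i - k))"

text \<open>The map \<open>S\<^sup>U \<times> S\<^sup>U\<^sup>' \<rightarrow> S\<^sup>U \<and> S\<^sup>U\<^sup>' = S\<^sup>U\<^sup>\<oplus>\<^sup>U\<^sup>'\<close>; within each isotypical part
  the coordinates of \<open>U\<close> precede those of \<open>U'\<close>.\<close>

fun sphere_smash :: "rep \<Rightarrow> vec option \<Rightarrow> vec option \<Rightarrow> vec option" where
  "sphere_smash U (Some v) (Some v') =
     Some (append_coords (fst U) (fst v) (fst v'), append_coords (snd U) (snd v) (snd v'))"
| "sphere_smash U None _ = None"
| "sphere_smash U _ None = None"

section \<open>Real spectra\<close>

text \<open>\<open>strmap E U V\<close> is the structure map \<open>\<Omega>\<^sup>U E\<^bsub>U\<oplus>V\<^esub> \<rightarrow> E\<^bsub>V\<^esub>\<close>.\<close>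

record 'a rspec =
  level :: "ro \<Rightarrow> 'a gspace"
  strmap :: "rep \<Rightarrow> ro \<Rightarrow> (vec option \<Rightarrow> 'a) \<Rightarrow> 'a"

text \<open>The last clause is compatibility of the family: the composite
  \<open>\<Omega>\<^sup>U\<^sup>\<oplus>\<^sup>U\<^sup>' E\<^bsub>U\<oplus>U'\<oplus>V\<^esub> \<cong> \<Omega>\<^sup>U \<Omega>\<^sup>U\<^sup>' E\<^bsub>U\<oplus>U'\<oplus>V\<^esub> \<rightarrow> \<Omega>\<^sup>U E\<^bsub>U\<oplus>V\<^esub> \<rightarrow> E\<^bsub>V\<^esub>\<close>
  is the structure map for \<open>U \<oplus> U'\<close>.  For \<open>U = 0\<close> it forces the structure map to be
  evaluation at the non-base point of \<open>S\<^sup>0\<close>.\<close>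

definition real_spectrum :: "'a rspec \<Rightarrow> bool" where
  "real_spectrum E \<longleftrightarrow>
     (\<forall>V. pointed_gspace (level E V)) \<and>
     (\<forall>U V. pointed_ghomeo (loops U (level E (ro_of U + V))) (level E V) (strmap E U V)) \<and>
     (\<forall>U U' V. \<forall>f \<in> topspace (gtop (loops (U + U') (level E (ro_of (U + U') + V)))).
        strmap E (U + U') V f =
        strmap E U V (\<lambda>s\<in>topspace (gtop (rep_sphere U)).
          strmap E U' (ro_of U + V) (\<lambda>s'\<in>topspace (gtop (rep_sphere U')).
            f (sphere_smash U s s'))))"

definition deloop :: "'a rspec \<Rightarrow> rep \<Rightarrow> ro \<Rightarrow> 'a \<Rightarrow> (vec option \<Rightarrow> 'a)" where
  "deloop E U V = inv_into (topspace (gtop (loops U (level E (ro_of U + V))))) (strmap E U V)"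

section \<open>Sum and difference on the infinite loop space \<open>E\<^bsub>V\<^esub>\<close>\<close>

definition coord0 :: "real \<Rightarrow> nat \<Rightarrow> real" where
  "coord0 t = (\<lambda>i. if i = 0 then t else 0)"

definition line_pt :: "real \<Rightarrow> vec option" where
  "line_pt t = Some (coord0 t, \<lambda>_. 0)"

text \<open>Concatenation of loops parametrized by \<open>\<real> \<union> {\<infinity>}\<close>: \<open>f\<close> runs over the negative
  half-line, via the increasing bijection \<open>t \<mapsto> - ln (- t)\<close> onto \<open>\<real>\<close>, and then \<open>g\<close> over
  the positive one, via \<open>ln\<close>.\<close>

definition loop_concat :: "(vec option \<Rightarrow> 'a) \<Rightarrow> (vec option \<Rightarrow> 'a) \<Rightarrow> (vec option \<Rightarrow> 'a)" where
  "loop_concat f g = (\<lambda>s\<in>topspace (gtop (rep_sphere rep_one)).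
     case s of
       None \<Rightarrow> f None
     | Some v \<Rightarrow>
         (let t = fst v 0 in
          if t < 0 then f (line_pt (- ln (- t)))
          else if t > 0 then g (line_pt (ln t))
          else f None))"

definition loop_reverse :: "(vec option \<Rightarrow> 'a) \<Rightarrow> (vec option \<Rightarrow> 'a)" where
  "loop_reverse f = (\<lambda>s\<in>topspace (gtop (rep_sphere rep_one)).
     case s of None \<Rightarrow> f None | Some v \<Rightarrow> f (line_pt (- fst v 0)))"

text \<open>The infinite loop structure on \<open>E\<^bsub>V\<^esub>\<close> is that of the ordinary spectrum
  \<open>{E\<^bsub>k+V\<^esub>}\<close>: it uses the delooping \<open>\<Omega>E\<^bsub>1+V\<^esub> = E\<^bsub>V\<^esub>\<close> for every \<open>V\<close>, including
  those written as \<open>W - \<alpha>\<close>.\<close>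

definition spec_add :: "'a rspec \<Rightarrow> ro \<Rightarrow> 'a \<Rightarrow> 'a \<Rightarrow> 'a" where
  "spec_add E V x y = strmap E rep_one V (loop_concat (deloop E rep_one V x) (deloop E rep_one V y))"

definition spec_neg :: "'a rspec \<Rightarrow> ro \<Rightarrow> 'a \<Rightarrow> 'a" where
  "spec_neg E V x = strmap E rep_one V (loop_reverse (deloop E rep_one V x))"

definition spec_diff :: "'a rspec \<Rightarrow> ro \<Rightarrow> 'a \<Rightarrow> 'a \<Rightarrow> 'a" where
  "spec_diff E V x y = spec_add E V x (spec_neg E V y)"

section \<open>Homotopy fixed points\<close>

text \<open>\<open>EZ/2\<close> is the infinite sphere (colimit topology) with the antipodal action.\<close>

lemma istopology_EZ2:
  "istopology (\<lambda>U. U \<subseteq> (\<Union>n. topspace (nsphere n)) \<and>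
                   (\<forall>n. openin (nsphere n) (U \<inter> topspace (nsphere n))))"
  (is "istopology ?P")
  unfolding istopology_def
proof (intro conjI allI impI)
  fix S T assume S: "?P S" and T: "?P T"
  show "S \<inter> T \<subseteq> (\<Union>n. topspace (nsphere n))" using S by blast
  fix n
  have "S \<inter> T \<inter> topspace (nsphere n) =
        (S \<inter> topspace (nsphere n)) \<inter> (T \<inter> topspace (nsphere n))" by blast
  then show "openin (nsphere n) (S \<inter> T \<inter> topspace (nsphere n))"
    using S T by (metis openin_Int)
next
  fix \<K> assume K: "\<forall>K\<in>\<K>. ?P K"
  show "\<Union>\<K> \<subseteq> (\<Union>n. topspace (nsphere n))" using K by blast
  fix n
  have "\<Union>\<K> \<inter> topspace (nsphere n) = \<Union>((\<lambda>K. K \<inter> topspace (nsphere n)) ` \<K>)" by blast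
  then show "openin (nsphere n) (\<Union>\<K> \<inter> topspace (nsphere n))"
    using K by (metis (no_types, lifting) imageE openin_Union)
qed

definition EZ2 :: "(nat \<Rightarrow> real) topology" where
  "EZ2 = topology (\<lambda>U. U \<subseteq> (\<Union>n. topspace (nsphere n)) \<and>
                       (\<forall>n. openin (nsphere n) (U \<inter> topspace (nsphere n))))"

lemma openin_EZ2:
  "openin EZ2 U \<longleftrightarrow> U \<subseteq> (\<Union>n. topspace (nsphere n)) \<and>
                   (\<forall>n. openin (nsphere n) (U \<inter> topspace (nsphere n)))"
  unfolding EZ2_def using istopology_EZ2 by (simp add: topology_inverse')

definition hfix :: "'a gspace \<Rightarrow> ((nat \<Rightarrow> real) \<Rightarrow> 'a) topology" where
  "hfix X = subtopology (map_top EZ2 (gtop X))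
     {c. \<forall>e\<in>topspace EZ2. c (\<lambda>i. - e i) = gact X (c e)}"

definition hfix_map :: "('a \<Rightarrow> 'b) \<Rightarrow> ((nat \<Rightarrow> real) \<Rightarrow> 'a) \<Rightarrow> ((nat \<Rightarrow> real) \<Rightarrow> 'b)" where
  "hfix_map h c = restrict (h \<circ> c) (topspace EZ2)"

text \<open>The map from strict to homotopy fixed points.\<close>

definition fix_to_hfix :: "'a \<Rightarrow> ((nat \<Rightarrow> real) \<Rightarrow> 'a)" where
  "fix_to_hfix x = restrict (\<lambda>_. x) (topspace EZ2)"

text \<open>The standard inclusion \<open>\<iota>\<close> of homotopy fixed points: forget equivariance and
  evaluate at a point of the contractible space \<open>EZ/2\<close>.\<close>

definition hfix_incl :: "((nat \<Rightarrow> real) \<Rightarrow> 'a) \<Rightarrow> 'a" where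
  "hfix_incl c = c (coord0 1)"

section \<open>The connecting map\<close>

text \<open>\<open>Z/2\<^sub>+ \<and> S\<^sup>1\<close> as the one-point compactification of \<open>Z/2 \<times> \<real>\<close>; \<open>False\<close> is
  the unit of \<open>Z/2\<close> and \<open>True\<close> the generator.\<close>

definition free_circle :: "(bool \<times> vec) option gspace" where
  "free_circle = \<lparr>
     gtop = Alexandroff_compactification
              (prod_topology (discrete_topology UNIV)
                (prod_topology (Euclidean_space 1) (Euclidean_space 0))),
     gbase = None,
     gact = map_option (\<lambda>(g, v). (\<not> g, v))\<rparr>"

text \<open>The pinch map \<open>p : S\<^sup>\<alpha> \<rightarrow> Z/2\<^sub>+ \<and> S\<^sup>1\<close> collapses the poles \<open>S\<^sup>0 = {0, \<infinity>}\<close>.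
  The copy of \<open>S\<^sup>1\<close> indexed by the unit is the negative half-line in increasing direction,
  so by equivariance the other copy is the positive half-line in decreasing direction:
  non-equivariantly \<open>p\<^sup>*(x, y)\<close> is \<open>x\<close> followed by the reverse of \<open>y\<close>, i.e. \<open>x - y\<close>.\<close>

definition pinch :: "vec option \<Rightarrow> (bool \<times> vec) option" where
  "pinch s = (case s of
     None \<Rightarrow> None
   | Some v \<Rightarrow>
       (let t = snd v 0 in
        if t = 0 then None else Some (t > 0, (coord0 (- ln \<bar>t\<bar>), \<lambda>_. 0))))"

text \<open>The isomorphism \<open>\<Omega>X \<times> \<Omega>X = Map\<^sub>*(Z/2\<^sub>+ \<and> S\<^sup>1, X)\<close>, under which conjugation is
  \<open>(x, y) \<mapsto> (\<sigma>(y), \<sigma>(x))\<close>.\<close>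

definition loop_pair ::
    "(vec option \<Rightarrow> 'a) \<Rightarrow> (vec option \<Rightarrow> 'a) \<Rightarrow> ((bool \<times> vec) option \<Rightarrow> 'a)" where
  "loop_pair x y = (\<lambda>s\<in>topspace (gtop free_circle).
     case s of None \<Rightarrow> x None | Some (g, v) \<Rightarrow> if g then y (Some v) else x (Some v))"

text \<open>For a finite \<open>Z/2\<close>-complex \<open>A\<close> with Spanier-Whitehead dual \<open>DA\<close>, the space of
  \<open>E\<^bsub>V\<^esub> \<and> DA\<close> is \<open>Map\<^sub>*(A, E\<^bsub>V\<^esub>)\<close>, and smashing with the dual of \<open>p\<close> is
  precomposition with \<open>p\<close>.  The connecting map
  \<open>E\<^bsub>V-1\<^esub> \<rightarrow> (E\<^bsub>V\<^esub> \<and> Z/2\<^sub>+ \<and> S\<^sup>-\<^sup>1)\<^sup>h \<rightarrow> (E\<^bsub>V\<^esub> \<and> S\<^sup>-\<^sup>\<alpha>)\<^sup>h = ER\<^bsub>V-\<alpha>\<^esub>\<close>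
  first sends \<open>x\<close> to \<open>(x, \<sigma>(x))\<close> and then applies \<open>p\<^sup>*\<close>.\<close>

definition connecting_map :: "'a rspec \<Rightarrow> ro \<Rightarrow> 'a \<Rightarrow> ((nat \<Rightarrow> real) \<Rightarrow> 'a)" where
  "connecting_map E V x =
     (let l = deloop E rep_one (V - ro_of rep_one) x
      in hfix_map (strmap E rep_alpha (V - ro_of rep_alpha) \<circ> precomp (rep_sphere rep_alpha) pinch)
           (fix_to_hfix (loop_pair l (gact (loops rep_one (level E V)) l))))"

definition boundary_map :: "'a rspec \<Rightarrow> ro \<Rightarrow> 'a \<Rightarrow> 'a" where
  "boundary_map E V = hfix_incl \<circ> connecting_map E V"

text \<open>The identification \<open>E\<^bsub>V-1\<^esub> = \<Omega>E\<^bsub>V\<^esub> = \<Omega>\<^sup>\<alpha>E\<^bsub>V\<^esub> = E\<^bsub>V-\<alpha>\<^esub>\<close> of spaces, induced by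
  the homeomorphism \<open>S\<^sup>\<alpha> = S\<^sup>1\<close> that is the identity of \<open>\<real> \<union> {\<infinity>}\<close>.\<close>

definition alpha_to_one :: "vec option \<Rightarrow> vec option" where
  "alpha_to_one = map_option prod.swap"

definition shift_ident :: "'a rspec \<Rightarrow> ro \<Rightarrow> 'a \<Rightarrow> 'a" where
  "shift_ident E V x =
     strmap E rep_alpha (V - ro_of rep_alpha)
       (precomp (rep_sphere rep_alpha) alpha_to_one (deloop E rep_one (V - ro_of rep_one) x))"

definition pointed_homotopic :: "'a gspace \<Rightarrow> 'b gspace \<Rightarrow> ('a \<Rightarrow> 'b) \<Rightarrow> ('a \<Rightarrow> 'b) \<Rightarrow> bool" where
  "pointed_homotopic X Y = homotopic_with (\<lambda>h. h (gbase X) = gbase Y) (gtop X) (gtop Y)"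

end

theory Submission
  imports Defs
begin

text \<open>The connecting map sends \<open>x\<close>, viewed as a loop \<open>l\<close> in \<open>E\<^bsub>V\<^esub>\<close>, to \<open>l\<close> followed by the reverse
  of \<open>\<sigma>l\<close>; the conventions match those of \<open>spec_diff\<close>, so the first homotopy is an equality.
  For the second one, \<open>E\<^bsub>V-\<alpha>\<^esub> = \<Omega>\<^sup>1\<^sup>+\<^sup>\<alpha>E\<^bsub>1+V\<^esub>\<close>, where the structure maps may be applied in either order.
  If \<open>m\<close> is the double loop corresponding to \<open>x\<close>, then both \<open>\<partial>x\<close> and \<open>x + \<sigma>x\<close> (with the action of
  \<open>E\<^bsub>V-\<alpha>\<^esub>\<close>) concatenate \<open>m\<close> with its conjugate, the former along the sign coordinate and the latter
  along the trivial one.  Rotating the plane \<open>1 + \<alpha> = \<complex>\<close> by a quarter turn deforms one into the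
  other.\<close>

section \<open>The compact-open topology\<close>

text \<open>The obstacle is that the two concatenations use different coordinates:
  \<open>spec_add\<close> on E_(V-\<alpha>) deloops along a trivial coordinate that the pinch map
  never sees. Only after one more delooping are both coordinates present, and this is where the
  compatibility of the structure maps enters. The signs agree because conjugation on the double loop
  space reflects the sign coordinate. Seen along the trivial coordinate, this reflection belongs to
  the action on the inner loop; once the direction of concatenation has turned into the sign
  direction, the same reflection reverses the second loop, as the pinch map does. What turns is the
  half-plane being collapsed. Each collapse is conjugated by the rotation, so \<open>m\<close>
  itself is never turned and both ends of the homotopy are exact equalities. The analytic burden is
  continuity, jointly in the time, the loop and the point of the sphere; for this the collapse must
  tend to infinity both at the boundary line of the half-plane and at infinity.\<close>

lemma continuous_map_into_map_top:
  assumes g: "continuous_map (prod_topology Z A) X (\<lambda>(z, a). g z a)"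
    and h: "\<And>z a. z \<in> topspace Z \<Longrightarrow> a \<in> topspace A \<Longrightarrow> h z a = g z a"
    and ext: "\<And>z. z \<in> topspace Z \<Longrightarrow> h z \<in> extensional (topspace A)"
  shows "continuous_map Z (map_top A X) h"
proof -
  have gz: "continuous_map A X (h z)" if "z \<in> topspace Z" for z
  proof (rule continuous_map_eq)
    have "continuous_map A (prod_topology Z A) (\<lambda>a. (z, a))"
      using that by (simp add: continuous_map_pairedI)
    from continuous_map_compose[OF this g] show "continuous_map A X (g z)"
      by (simp add: o_def)
  qed (use that h in auto)
  have carrier: "h z \<in> map_carrier A X" if "z \<in> topspace Z" for z
    using gz ext that by (simp add: map_carrier_def)
  show ?thesis
    unfolding map_top_def
  proof (rule continuous_on_generated_topo)
    fix W assume "W \<in> {{f \<in> map_carrier A X. f ` K \<subseteq> U} | K U. compactin A K \<and> openin X U}"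
    then obtain K U where W: "W = {f \<in> map_carrier A X. f ` K \<subseteq> U}"
      and K: "compactin A K" and U: "openin X U" by blast
    let ?G = "{p \<in> topspace (prod_topology Z A). (\<lambda>(z, a). g z a) p \<in> U}"
    have G: "openin (prod_topology Z A) ?G"
      using openin_continuous_map_preimage[OF g U] .
    have KA: "K \<subseteq> topspace A" using K by (simp add: compactin_subset_topspace)
    show "openin Z (h -` W \<inter> topspace Z)"
    proof (subst openin_subopen, intro ballI)
      fix z assume z: "z \<in> h -` W \<inter> topspace Z"
      then have "g z a \<in> U" if "a \<in> K" for a
        using h[of z a] that KA W by fastforce
      then have "{z} \<times> K \<subseteq> ?G" using z KA by auto
      \<comment> \<open>Tube lemma: since \<open>K\<close> is compact, a single neighbourhood
        \<open>N\<close> of \<open>z\<close> serves all its points.\<close>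
      then obtain N O' where "openin Z N" "z \<in> N" "K \<subseteq> O'" "N \<times> O' \<subseteq> ?G"
        using tube_lemma_right[OF G K, of z] z by blast
      moreover have "N \<subseteq> h -` W \<inter> topspace Z"
      proof
        fix w assume "w \<in> N"
        then have w: "w \<in> topspace Z"
          using \<open>openin Z N\<close> openin_subset by blast
        have "h w a \<in> U" if "a \<in> K" for a
          using that \<open>w \<in> N\<close> \<open>K \<subseteq> O'\<close> \<open>N \<times> O' \<subseteq> ?G\<close> KA h[OF w, of a] by fastforce
        then show "w \<in> h -` W \<inter> topspace Z"
          using w carrier W by auto
      qed
      ultimately show "\<exists>T. openin Z T \<and> z \<in> T \<and> T \<subseteq> h -` W \<inter> topspace Z" by blast
    qed
  next
    have "map_carrier A X \<in> {{f \<in> map_carrier A X. f ` K \<subseteq> U} | K U. compactin A K \<and> openin X U}"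
      using compactin_empty openin_empty by fastforce
    then show "h ` topspace Z \<subseteq>
        \<Union> {{f \<in> map_carrier A X. f ` K \<subseteq> U} | K U. compactin A K \<and> openin X U}"
      using carrier by blast
  qed
qed

text \<open>A compact Hausdorff space is locally compact, so \<open>a\<close> has a compact
  neighbourhood that \<open>f\<close> still maps into \<open>U\<close>; maps sending it into
  \<open>U\<close> form a subbasic open set. Joint continuity is needed because the homotopy moves
  the loop and the point at which it is evaluated simultaneously.\<close>

lemma continuous_map_eval:
  assumes "compact_space A" "Hausdorff_space A"
  shows "continuous_map (prod_topology (map_top A X) A) X (\<lambda>(f, a). f a)"
  unfolding continuous_map_def
proof (intro conjI allI impI)
  show "(\<lambda>(f, a). f a) \<in> topspace (prod_topology (map_top A X) A) \<rightarrow> topspace X"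
    by (auto simp: map_carrier_def continuous_map_def)
  fix U assume U: "openin X U"
  let ?G = "{p \<in> topspace (prod_topology (map_top A X) A). (case p of (f, a) \<Rightarrow> f a) \<in> U}"
  have nb: "neighbourhood_base_of (compactin A) A"
    using assms compact_Hausdorff_imp_regular_space compact_imp_locally_compact_space
      locally_compact_imp_neighbourhood_base by blast
  show "openin (prod_topology (map_top A X) A) ?G"
  proof (subst openin_subopen, intro ballI)
    fix p assume "p \<in> ?G"
    then obtain f a where p: "p = (f, a)" and f: "f \<in> map_carrier A X" and a: "a \<in> topspace A"
      and fa: "f a \<in> U" by (cases p) auto
    have "openin A {b \<in> topspace A. f b \<in> U}"
      using f U by (intro openin_continuous_map_preimage[of A X]) (auto simp: map_carrier_def)
    then obtain O' K where O': "openin A O'" "a \<in> O'" "O' \<subseteq> K" "compactin A K"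
      and K: "K \<subseteq> {b \<in> topspace A. f b \<in> U}"
      using nb a fa unfolding neighbourhood_base_of by (metis (mono_tags, lifting) mem_Collect_eq)
    let ?M = "{f \<in> map_carrier A X. f ` K \<subseteq> U}"
    have "openin (map_top A X) ?M"
      unfolding map_top_def using O' U by (intro topology_generated_by_Basis) blast
    then have "openin (prod_topology (map_top A X) A) (?M \<times> O')"
      using O' by (simp add: openin_prod_Times_iff)
    moreover have "p \<in> ?M \<times> O'" using p f K O' by auto
    moreover have "?M \<times> O' \<subseteq> ?G"
      using O'(3) openin_subset[OF O'(1)] by auto
    ultimately show "\<exists>T. openin (prod_topology (map_top A X) A) T \<and> p \<in> T \<and> T \<subseteq> ?G"
      by blast
  qed
qed

section \<open>Pointed mapping spaces: adjunction and evaluation\<close>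

lemma topspace_gmap:
  "topspace (gtop (gmap A X)) =
     {f \<in> extensional (topspace (gtop A)). continuous_map (gtop A) (gtop X) f \<and> f (gbase A) = gbase X}"
  by (auto simp: gmap_def map_carrier_def)

text \<open>Here \<open>g\<close> is the formula whose joint continuity is checked, and
  \<open>h\<close> its extensional representative, as points of a mapping space have to be
  \<open>extensional\<close>.\<close>

lemma continuous_map_into_gmap:
  assumes "continuous_map (prod_topology Z (gtop A)) (gtop X) (\<lambda>(z, a). g z a)"
    and "\<And>z a. z \<in> topspace Z \<Longrightarrow> a \<in> topspace (gtop A) \<Longrightarrow> h z a = g z a"
    and "\<And>z. z \<in> topspace Z \<Longrightarrow> h z \<in> extensional (topspace (gtop A))"
    and "\<And>z. z \<in> topspace Z \<Longrightarrow> h z (gbase A) = gbase X"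
  shows "continuous_map Z (gtop (gmap A X)) h"
  using continuous_map_into_map_top[OF assms(1-3)] assms(4)
  by (auto simp: gmap_def continuous_map_in_subtopology)

lemma continuous_map_gmap_eval:
  assumes "compact_space (gtop A)" "Hausdorff_space (gtop A)"
    and f: "continuous_map Z (gtop (gmap A X)) f" and a: "continuous_map Z (gtop A) a"
  shows "continuous_map Z (gtop X) (\<lambda>z. f z (a z))"
proof -
  have "continuous_map Z (map_top (gtop A) (gtop X)) f"
    using f by (simp add: gmap_def continuous_map_in_subtopology)
  then have "continuous_map Z (prod_topology (map_top (gtop A) (gtop X)) (gtop A)) (\<lambda>z. (f z, a z))"
    using a by (rule continuous_map_pairedI)
  from continuous_map_compose[OF this continuous_map_eval[OF assms(1,2)]] show ?thesis
    by (simp add: o_def)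
qed

section \<open>Coordinates on representation spheres\<close>

text \<open>Charts trade pairs of sequences for one real or complex number, so that openness and
  compactness can be checked in ordinary Euclidean space; the point at infinity stays
  \<open>None\<close>.\<close>

definition sphere_chart :: "rep \<Rightarrow> ('c::euclidean_space \<Rightarrow> vec) \<Rightarrow> bool" where
  "sphere_chart U e \<longleftrightarrow>
     homeomorphic_map euclidean
       (prod_topology (Euclidean_space (fst U)) (Euclidean_space (snd U))) e"

lemma gbase_rep_sphere [simp]: "gbase (rep_sphere U) = None"
  by (simp add: rep_sphere_def)

lemma sphere_chart_props:
  fixes e :: "'c::euclidean_space \<Rightarrow> vec"
  assumes "sphere_chart U e"
  defines "S \<equiv> gtop (rep_sphere U)"
  shows sphere_chart_topspace: "topspace S = insert None (range (\<lambda>x. Some (e x)))"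
    and sphere_chart_inj: "e x = e y \<longleftrightarrow> x = y"
    and sphere_chart_continuous: "continuous_map euclidean S (\<lambda>x. Some (e x))"
    and sphere_chart_open: "open W \<Longrightarrow> openin S ((\<lambda>x. Some (e x)) ` W)"
    and compact_space_sphere: "compact_space S"
    and Hausdorff_space_sphere: "Hausdorff_space S"
proof -
  let ?Y = "prod_topology (Euclidean_space (fst U)) (Euclidean_space (snd U))"
  have hom: "homeomorphic_map euclidean ?Y e" using assms by (simp add: sphere_chart_def)
  have S: "S = Alexandroff_compactification ?Y" by (simp add: S_def rep_sphere_def)
  have surj: "e ` UNIV = topspace ?Y"
    using homeomorphic_imp_surjective_map[OF hom] by (simp add: topspace_euclidean)
  show "topspace S = insert None (range (\<lambda>x. Some (e x)))"
    using surj by (auto simp: S topspace_Alexandroff_compactification image_image[symmetric])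
  show "e x = e y \<longleftrightarrow> x = y"
    using homeomorphic_imp_injective_map[OF hom] by (auto dest: inj_onD)
  show "continuous_map euclidean S (\<lambda>x. Some (e x))"
    using continuous_map_compose[OF homeomorphic_imp_continuous_map[OF hom] continuous_map_Some]
    by (simp add: S o_def)
  show "openin S ((\<lambda>x. Some (e x)) ` W)" if "open W"
  proof -
    have "openin ?Y (e ` W)"
      using homeomorphic_imp_open_map[OF hom] that by (simp add: open_map_def)
    then have "openin S (Some ` (e ` W))" by (simp add: S)
    then show ?thesis by (simp add: image_image)
  qed
  show "compact_space S" by (simp add: S)
  have hs: "(euclidean :: 'c topology) homeomorphic_space ?Y"
    using hom homeomorphic_map_imp_homeomorphic_space by blast
  show "Hausdorff_space S"
    using homeomorphic_Hausdorff_space[OF hs] homeomorphic_locally_compact_space[OF hs]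
    by (simp add: S Hausdorff_space_Alexandroff_compactification locally_compact_space_euclidean)
qed

text \<open>Open sets of the compactification are open sets of the finite part or complements of
  compact subsets of it: \<open>op\<close> tests the former, \<open>cl\<close> the neighbourhoods of
  infinity.\<close>

lemma continuous_map_into_sphere:
  fixes e :: "'c::euclidean_space \<Rightarrow> vec"
  assumes e: "sphere_chart U e"
    and P: "\<And>z. z \<in> topspace Z \<Longrightarrow> P z \<in> insert None (range (\<lambda>x. Some (e x)))"
    and op: "\<And>W. open W \<Longrightarrow> openin Z {z \<in> topspace Z. P z \<in> (\<lambda>x. Some (e x)) ` W}"
    and cl: "\<And>C. compact C \<Longrightarrow> closedin Z {z \<in> topspace Z. P z \<in> (\<lambda>x. Some (e x)) ` C}"
  shows "continuous_map Z (gtop (rep_sphere U)) P"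
proof -
  let ?Y = "prod_topology (Euclidean_space (fst U)) (Euclidean_space (snd U))"
  have hom: "homeomorphic_map euclidean ?Y e" using e by (simp add: sphere_chart_def)
  have surj: "e ` UNIV = topspace ?Y"
    using homeomorphic_imp_surjective_map[OF hom] by (simp add: topspace_euclidean)
  have S: "gtop (rep_sphere U) = Alexandroff_compactification ?Y" by (simp add: rep_sphere_def)
  show ?thesis
    unfolding continuous_map_def
  proof (intro conjI allI impI)
    show "P \<in> topspace Z \<rightarrow> topspace (gtop (rep_sphere U))"
      using P sphere_chart_topspace[OF e] by auto
    fix W assume "openin (gtop (rep_sphere U)) W"
    then consider O' where "openin ?Y O'" "W = Some ` O'"
      | C where "compactin ?Y C" "W = insert None (Some ` (topspace ?Y - C))"
      unfolding S openin_Alexandroff_compactification by blast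
    then show "openin Z {z \<in> topspace Z. P z \<in> W}"
    proof cases
      case 1
      have "open {x. e x \<in> O'}"
        using openin_continuous_map_preimage[OF homeomorphic_imp_continuous_map[OF hom] 1(1)] by simp
      moreover have "W = (\<lambda>x. Some (e x)) ` {x. e x \<in> O'}"
      proof -
        have "O' \<subseteq> range e" using openin_subset[OF 1(1)] surj by simp
        then have "e ` {x. e x \<in> O'} = O'" by blast
        then show ?thesis using 1(2) by (metis image_image)
      qed
      ultimately show ?thesis using op by simp
    next
      case 2
      obtain C' where C': "C = e ` C'"
        using compactin_subset_topspace[OF 2(1)] surj by (metis subset_imageE)
      have "compact C'"
        using homeomorphic_map_compactness[OF hom, of C'] 2(1) C' by simp
      from cl[OF this] have "openin Z (topspace Z - {z \<in> topspace Z. P z \<in> (\<lambda>x. Some (e x)) ` C'})"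
        by (simp add: closedin_def)
      moreover have "topspace Z - {z \<in> topspace Z. P z \<in> (\<lambda>x. Some (e x)) ` C'} =
          {z \<in> topspace Z. P z \<in> W}"
      proof -
        have "P z \<in> W \<longleftrightarrow> P z \<notin> (\<lambda>x. Some (e x)) ` C'" if "z \<in> topspace Z" for z
        proof -
          have "topspace ?Y - C = e ` (- C')"
            using surj C' homeomorphic_imp_injective_map[OF hom]
            by (metis Compl_eq_Diff_UNIV image_set_diff topspace_euclidean)
          then have W: "W = insert None ((\<lambda>x. Some (e x)) ` (- C'))"
            using 2(2) by (simp add: image_image)
          have "P z = None \<or> (\<exists>x. P z = Some (e x))" using P[OF that] by auto
          then show ?thesis using sphere_chart_inj[OF e] by (auto simp: W)
        qed
        then show ?thesis by blast
      qed
      ultimately show ?thesis by simp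
    qed
  qed
qed

text \<open>A homeomorphism of the finite parts is proper and so extends over infinity: a compact
  set pulls back to its image under \<open>\<psi>\<close>, which is compact and hence closed in a
  Hausdorff space.\<close>

lemma continuous_map_sphere_homeo:
  fixes e :: "'c::euclidean_space \<Rightarrow> vec" and e' :: "'d::euclidean_space \<Rightarrow> vec"
  assumes e: "sphere_chart U e" and e': "sphere_chart U' e'"
    and \<phi>: "continuous_on UNIV \<phi>" and \<psi>: "continuous_on UNIV \<psi>"
    and inv: "\<And>x. \<psi> (\<phi> x) = x" "\<And>y. \<phi> (\<psi> y) = y"
    and m: "m None = None" "\<And>x. m (Some (e x)) = Some (e' (\<phi> x))"
  shows "continuous_map (gtop (rep_sphere U)) (gtop (rep_sphere U')) m"
proof (rule continuous_map_into_sphere[OF e'])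
  let ?S = "gtop (rep_sphere U)"
  have eq: "{z \<in> topspace ?S. m z \<in> (\<lambda>x. Some (e' x)) ` W} = (\<lambda>x. Some (e x)) ` \<psi> ` W" for W
  proof (intro subset_antisym subsetI)
    fix z assume "z \<in> {z \<in> topspace ?S. m z \<in> (\<lambda>x. Some (e' x)) ` W}"
    then obtain x where "z = Some (e x)" "\<phi> x \<in> W"
      using m sphere_chart_inj[OF e'] unfolding sphere_chart_topspace[OF e] by auto
    then show "z \<in> (\<lambda>x. Some (e x)) ` \<psi> ` W"
      using inv(1)[of x] by (metis imageI)
  next
    fix z assume "z \<in> (\<lambda>x. Some (e x)) ` \<psi> ` W"
    then show "z \<in> {z \<in> topspace ?S. m z \<in> (\<lambda>x. Some (e' x)) ` W}"
      using m inv unfolding sphere_chart_topspace[OF e] by auto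
  qed
  show "m z \<in> insert None (range (\<lambda>x. Some (e' x)))" if "z \<in> topspace ?S" for z
    using that m by (auto simp: sphere_chart_topspace[OF e])
  show "openin ?S {z \<in> topspace ?S. m z \<in> (\<lambda>x. Some (e' x)) ` W}" if "open W" for W
  proof -
    have "\<psi> ` W = \<phi> -` W" using inv by (auto simp: image_iff) metis
    then have "open (\<psi> ` W)" using \<phi> that by (simp add: open_vimage)
    then show ?thesis unfolding eq by (rule sphere_chart_open[OF e])
  qed
  show "closedin ?S {z \<in> topspace ?S. m z \<in> (\<lambda>x. Some (e' x)) ` C}" if "compact C" for C
  proof -
    have "compact (\<psi> ` C)" using that \<psi> by (meson compact_continuous_image continuous_on_subset subset_UNIV)
    then have "compactin ?S ((\<lambda>x. Some (e x)) ` \<psi> ` C)"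
      using image_compactin[OF _ sphere_chart_continuous[OF e]] by simp
    then show ?thesis
      unfolding eq using Hausdorff_space_sphere[OF e] by (simp add: compactin_imp_closedin)
  qed
qed

lemma openin_prod_image:
  assumes W: "openin (prod_topology X Y) W" and f: "open_map X X' f" and g: "open_map Y Y' g"
  shows "openin (prod_topology X' Y') ((\<lambda>(x, y). (f x, g y)) ` W)"
proof (subst openin_subopen, intro ballI)
  fix p assume "p \<in> (\<lambda>(x, y). (f x, g y)) ` W"
  then obtain x y where xy: "(x, y) \<in> W" "p = (f x, g y)" by auto
  then obtain A B where AB: "openin X A" "openin Y B" "x \<in> A" "y \<in> B" "A \<times> B \<subseteq> W"
    using W unfolding openin_prod_topology_alt by meson
  then have "openin (prod_topology X' Y') (f ` A \<times> g ` B)"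
    using f g by (simp add: open_map_def openin_prod_Times_iff)
  moreover have "f ` A \<times> g ` B \<subseteq> (\<lambda>(x, y). (f x, g y)) ` W" using AB by force
  ultimately show "\<exists>T. openin (prod_topology X' Y') T \<and> p \<in> T \<and> T \<subseteq> (\<lambda>(x, y). (f x, g y)) ` W"
    using xy AB by blast
qed

section \<open>Charts of the spheres of 1, \<alpha> and 1 + \<alpha>\<close>

definition line_vec :: "real \<Rightarrow> vec" where "line_vec t = (coord0 t, \<lambda>_. 0)"
definition sign_vec :: "real \<Rightarrow> vec" where "sign_vec t = (\<lambda>_. 0, coord0 t)"
text \<open>With the sign coordinate as imaginary part, the action on the plane is complex
  conjugation.\<close>

definition plane_vec :: "complex \<Rightarrow> vec" where "plane_vec z = (coord0 (Re z), coord0 (Im z))"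

lemma coord0_0 [simp]: "coord0 t 0 = t" "coord0 0 = (\<lambda>_. 0)"
  by (auto simp: coord0_def)

lemma continuous_map_coord0:
  "continuous_on UNIV f \<Longrightarrow> continuous_map euclidean (Euclidean_space (Suc 0)) (\<lambda>x. coord0 (f x))"
  by (auto simp: Euclidean_space_def continuous_map_in_subtopology continuous_map_componentwise_UNIV
      coord0_def)

lemma continuous_map_const_0: "continuous_map X (Euclidean_space 0) (\<lambda>_. \<lambda>_. 0)"
  by (simp add: topspace_Euclidean_space)

lemma continuous_map_coordinate_of:
  assumes "continuous_map X (Euclidean_space n) f"
  shows "continuous_map X euclideanreal (\<lambda>x. f x i)"
  using assms
  by (auto simp: Euclidean_space_def continuous_map_in_subtopology continuous_map_componentwise_UNIV)

lemma Euclidean_space_1_coord0: "x \<in> topspace (Euclidean_space (Suc 0)) \<Longrightarrow> coord0 (x 0) = x"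
  by (force simp: topspace_Euclidean_space coord0_def)

lemma sphere_chart_line: "sphere_chart rep_one line_vec"
  unfolding sphere_chart_def
proof (rule homeomorphic_maps_imp_map)
  show "homeomorphic_maps euclidean
     (prod_topology (Euclidean_space (fst rep_one)) (Euclidean_space (snd rep_one)))
     line_vec (\<lambda>v. fst v 0)"
    unfolding homeomorphic_maps_def line_vec_def
    using continuous_map_coordinate_of[OF continuous_map_fst,
        of "Suc 0" "Euclidean_space 0" 0]
    by (auto simp: o_def continuous_map_pairedI continuous_map_coord0 continuous_map_const_0
        Euclidean_space_1_coord0 topspace_Euclidean_space)
qed

lemma sphere_chart_sign: "sphere_chart rep_alpha sign_vec"
  unfolding sphere_chart_def
proof (rule homeomorphic_maps_imp_map)
  show "homeomorphic_maps euclidean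
     (prod_topology (Euclidean_space (fst rep_alpha)) (Euclidean_space (snd rep_alpha)))
     sign_vec (\<lambda>v. snd v 0)"
    unfolding homeomorphic_maps_def sign_vec_def
    using continuous_map_coordinate_of[OF continuous_map_snd,
        of "Euclidean_space 0" "Suc 0" 0]
    by (auto simp: o_def continuous_map_pairedI continuous_map_coord0 continuous_map_const_0
        Euclidean_space_1_coord0 topspace_Euclidean_space)
qed

lemma sphere_chart_plane: "sphere_chart (1, 1) plane_vec"
  unfolding sphere_chart_def
proof (rule homeomorphic_maps_imp_map)
  let ?E = "Euclidean_space (Suc 0)"
  have "continuous_map (prod_topology ?E ?E) euclidean (\<lambda>v. (fst v 0, snd v 0))"
    using continuous_map_coordinate_of[OF continuous_map_fst, of "Suc 0" ?E 0]
      continuous_map_coordinate_of[OF continuous_map_snd, of ?E "Suc 0" 0]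
    by (simp add: o_def continuous_map_pairedI flip: prod_topology_euclidean)
  moreover have "continuous_map euclidean euclidean (\<lambda>(x, y). Complex x y)"
    by (simp add: case_prod_unfold Complex_eq) (intro continuous_intros)
  ultimately have "continuous_map (prod_topology ?E ?E) euclidean
      ((\<lambda>(x, y). Complex x y) \<circ> (\<lambda>v. (fst v 0, snd v 0)))"
    by (rule continuous_map_compose)
  moreover have "continuous_map euclidean ?E (\<lambda>z. coord0 (Re z))"
    "continuous_map euclidean ?E (\<lambda>z. coord0 (Im z))"
    by (intro continuous_map_coord0 continuous_intros)+
  ultimately
  show "homeomorphic_maps euclidean
     (prod_topology (Euclidean_space (fst (1, 1))) (Euclidean_space (snd (1, 1))))
     plane_vec (\<lambda>v. Complex (fst v 0) (snd v 0))"
    unfolding homeomorphic_maps_def plane_vec_def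
    by (auto simp: o_def continuous_map_pairedI Euclidean_space_1_coord0)
qed

lemma line_pt_eq: "line_pt t = Some (line_vec t)"
  by (simp add: line_pt_def line_vec_def)

text \<open>Trivial and sign coordinates are stored in separate sequences, so both orders of
  smashing reach the same point and no swap of coordinates, hence no sign, intervenes.\<close>

lemma sphere_smash_line_sign:
  "sphere_smash rep_one (Some (line_vec s)) (Some (sign_vec a)) = Some (plane_vec (Complex s a))"
  "sphere_smash rep_alpha (Some (sign_vec a)) (Some (line_vec s)) = Some (plane_vec (Complex s a))"
  by (auto simp: line_vec_def sign_vec_def plane_vec_def append_coords_def coord0_def fun_eq_iff)

lemma sphere_smash_None [simp]: "sphere_smash U s None = None"
  by (cases s) auto

text \<open>The smash is at infinity as soon as one factor is, so the preimage of a set of finite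
  points lies in the product of the two charts, where \<open>l\<close> parametrizes it. Compact sets
  therefore have compact preimages.\<close>

lemma continuous_map_smash:
  fixes e :: "real \<Rightarrow> vec" and e' :: "real \<Rightarrow> vec"
  assumes e: "sphere_chart U e" and e': "sphere_chart U' e'" and e2: "sphere_chart W e2"
    and k: "\<And>x y. sphere_smash U (Some (e x)) (Some (e' y)) = Some (e2 (k (x, y)))"
    and cont: "continuous_on UNIV k" "continuous_on UNIV l"
    and inv: "\<And>p. l (k p) = p" "\<And>z. k (l z) = z"
  shows "continuous_map (prod_topology (gtop (rep_sphere U)) (gtop (rep_sphere U')))
    (gtop (rep_sphere W)) (\<lambda>(s, s'). sphere_smash U s s')"
proof (rule continuous_map_into_sphere[OF e2])
  let ?S = "prod_topology (gtop (rep_sphere U)) (gtop (rep_sphere U'))"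
  let ?j = "\<lambda>(x, y). (Some (e x), Some (e' y))"
  have cases: "z \<in> topspace ?S \<longleftrightarrow> (\<exists>s s'. z = (s, s') \<and>
      (s = None \<or> (\<exists>x. s = Some (e x))) \<and> (s' = None \<or> (\<exists>x. s' = Some (e' x))))" for z
    by (cases z) (auto simp: sphere_chart_topspace[OF e] sphere_chart_topspace[OF e'])
  have eq: "{z \<in> topspace ?S. (case z of (s, s') \<Rightarrow> sphere_smash U s s') \<in> (\<lambda>x. Some (e2 x)) ` A}
      = ?j ` l ` A" for A
  proof (intro subset_antisym subsetI)
    fix z assume "z \<in> {z \<in> topspace ?S. (case z of (s, s') \<Rightarrow> sphere_smash U s s') \<in> (\<lambda>x. Some (e2 x)) ` A}"
    then obtain x y where z: "z = (Some (e x), Some (e' y))"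
      and "Some (e2 (k (x, y))) \<in> (\<lambda>x. Some (e2 x)) ` A"
      unfolding mem_Collect_eq cases using k by auto
    then have "k (x, y) \<in> A" using sphere_chart_inj[OF e2] by auto
    then have "(x, y) \<in> l ` A" using inv(1)[of "(x, y)"] by (metis imageI)
    then show "z \<in> ?j ` l ` A" using z by force
  next
    fix z assume "z \<in> ?j ` l ` A"
    then obtain a where a: "a \<in> A" and z: "z = ?j (l a)" by blast
    obtain x y where xy: "l a = (x, y)" by fastforce
    then have "k (x, y) = a" using inv(2) by metis
    then show "z \<in> {z \<in> topspace ?S. (case z of (s, s') \<Rightarrow> sphere_smash U s s') \<in> (\<lambda>x. Some (e2 x)) ` A}"
      using a z xy k cases by auto
  qed
  show "(case z of (s, s') \<Rightarrow> sphere_smash U s s') \<in> insert None (range (\<lambda>x. Some (e2 x)))"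
    if "z \<in> topspace ?S" for z
    using that k unfolding cases by auto
  show "openin ?S {z \<in> topspace ?S. (case z of (s, s') \<Rightarrow> sphere_smash U s s') \<in> (\<lambda>x. Some (e2 x)) ` A}"
    if "open A" for A
  proof -
    have "l ` A = k -` A" using inv by (auto simp: image_iff) metis
    then have "open (l ` A)" using cont that by (simp add: open_vimage)
    then show ?thesis unfolding eq
      using openin_prod_image[of euclidean euclidean "l ` A" _ "\<lambda>x. Some (e x)" _ "\<lambda>x. Some (e' x)"]
        sphere_chart_open[OF e] sphere_chart_open[OF e'] by (simp add: open_map_def)
  qed
  show "closedin ?S {z \<in> topspace ?S. (case z of (s, s') \<Rightarrow> sphere_smash U s s') \<in> (\<lambda>x. Some (e2 x)) ` C}"
    if "compact C" for C
  proof -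
    have "compact (l ` C)" using that cont by (meson compact_continuous_image continuous_on_subset subset_UNIV)
    moreover have "continuous_map (prod_topology euclidean euclidean) ?S ?j"
      using sphere_chart_continuous[OF e] sphere_chart_continuous[OF e']
      by (simp only: continuous_map_prod_top simp_thms)
    then have "continuous_map euclidean ?S ?j" by (simp only: prod_topology_euclidean)
    ultimately have "compactin ?S (?j ` l ` C)"
      using image_compactin[of euclidean] by simp
    then show ?thesis
      unfolding eq using Hausdorff_space_sphere[OF e] Hausdorff_space_sphere[OF e']
      by (simp add: compactin_imp_closedin Hausdorff_space_prod_topology)
  qed
qed

lemma continuous_map_smash_one_alpha:
  "continuous_map (prod_topology (gtop (rep_sphere rep_one)) (gtop (rep_sphere rep_alpha)))
    (gtop (rep_sphere (1, 1))) (\<lambda>(s, a). sphere_smash rep_one s a)"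
  by (rule continuous_map_smash[OF sphere_chart_line sphere_chart_sign sphere_chart_plane,
        where k = "\<lambda>p. Complex (fst p) (snd p)" and l = "\<lambda>z. (Re z, Im z)"])
     (auto simp: sphere_smash_line_sign[unfolded One_nat_def] simp del: sphere_smash.simps intro!: continuous_intros)

lemma continuous_map_smash_alpha_one:
  "continuous_map (prod_topology (gtop (rep_sphere rep_alpha)) (gtop (rep_sphere rep_one)))
    (gtop (rep_sphere (1, 1))) (\<lambda>(a, s). sphere_smash rep_alpha a s)"
  by (rule continuous_map_smash[OF sphere_chart_sign sphere_chart_line sphere_chart_plane,
        where k = "\<lambda>p. Complex (snd p) (fst p)" and l = "\<lambda>z. (Im z, Re z)"])
     (auto simp: sphere_smash_line_sign[unfolded One_nat_def] simp del: sphere_smash.simps intro!: continuous_intros)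

section \<open>Rotating the sum of two double loops\<close>

text \<open>The turn is clockwise, so that \<open>Re (rot t * z)\<close>, the coordinate along which
  loops are joined, moves from \<open>Re z\<close> at time 0 to \<open>Im z\<close> at time
  1.\<close>

definition rot :: "real \<Rightarrow> complex" where
  "rot t = cis (- (pi * t / 2))"

lemma rot_cnj [simp]: "rot t * cnj (rot t) = 1" "cnj (rot t) * rot t = 1"
  by (simp_all add: rot_def cis_cnj cis_mult)

lemma rot_cancel [simp]:
  "rot t * (cnj (rot t) * z) = z" "cnj (rot t) * (rot t * z) = z"
  by (simp_all add: mult.assoc[symmetric])

lemma rot_0 [simp]: "rot 0 = 1" and rot_1 [simp]: "rot 1 = - \<i>"
  by (simp_all add: rot_def complex_eq_iff)

lemma continuous_rot [continuous_intros]: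
  "continuous_on A f \<Longrightarrow> continuous_on A (\<lambda>x. rot (f x))"
  unfolding rot_def by (intro continuous_intros) auto

text \<open>Conjugated by the rotation, the diffeomorphism from a half-plane onto the plane that
  underlies the first half of \<open>loop_concat\<close>.\<close>

definition half_plane_map :: "real \<Rightarrow> complex \<Rightarrow> complex" where
  "half_plane_map t z =
     cnj (rot t) * Complex (- ln (- Re (rot t * z))) (Im (rot t * z))"

text \<open>A Pontryagin-Thom collapse: an open half-plane is stretched over the whole plane and its
  complement goes to infinity. The logarithm diverges at the boundary line, which makes the two
  cases fit together.\<close>

definition half_collapse :: "real \<Rightarrow> vec option \<Rightarrow> vec option" where
  "half_collapse t v = (case v of None \<Rightarrow> None | Some p \<Rightarrow>
     let z = Complex (fst p 0) (snd p 0) in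
     if Re (rot t * z) < 0 then Some (plane_vec (half_plane_map t z)) else None)"

lemma half_collapse_simps [simp]:
  "half_collapse t None = None"
  "half_collapse t (Some (plane_vec z)) =
     (if Re (rot t * z) < 0 then Some (plane_vec (half_plane_map t z)) else None)"
  by (simp_all add: half_collapse_def plane_vec_def)

definition half_plane_inv :: "real \<Rightarrow> complex \<Rightarrow> complex" where
  "half_plane_inv t u = cnj (rot t) * Complex (- exp (- Re (rot t * u))) (Im (rot t * u))"

lemma half_plane_inverse:
  "Re (rot t * half_plane_inv t u) < 0" "half_plane_map t (half_plane_inv t u) = u"
  "Re (rot t * z) < 0 \<Longrightarrow> half_plane_inv t (half_plane_map t z) = z"
  by (simp_all add: half_plane_inv_def half_plane_map_def del: times_complex.sel)

text \<open>On finite points the half-plane is open, jointly with \<open>t\<close>, and the formula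
  is continuous there. Continuity at the boundary line and at infinity amounts to closed preimages
  of compact sets, which the explicit inverse provides.\<close>

lemma continuous_map_half_collapse:
  "continuous_map (prod_topology (top_of_set {0..1}) (gtop (rep_sphere (1, 1))))
     (gtop (rep_sphere (1, 1))) (\<lambda>(t, v). half_collapse t v)"
proof (rule continuous_map_into_sphere[OF sphere_chart_plane])
  let ?S = "gtop (rep_sphere (1, 1))"
  let ?Z = "prod_topology (top_of_set {0..1::real}) ?S"
  let ?I = "{0..1::real}"
  let ?j = "\<lambda>(t::real, z). (t, Some (plane_vec z))"
  let ?Dom = "{p. Re (rot (fst p) * snd p) < 0}"
  let ?hp = "\<lambda>p. half_plane_map (fst p) (snd p)"
  have IZ: "prod_topology (top_of_set ?I) (euclidean :: complex topology) = top_of_set (?I \<times> UNIV)"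
    using prod_topology_subtopology_eu[of ?I "UNIV :: complex set"] by simp
  have pre: "z \<in> topspace ?Z \<longleftrightarrow>
      (\<exists>t v. t \<in> ?I \<and> z = (t, v) \<and> (v = None \<or> (\<exists>x. v = Some (plane_vec x))))" for z
    by (cases z) (auto simp: sphere_chart_topspace[OF sphere_chart_plane] simp del: One_nat_def)
  have eq1: "{z \<in> topspace ?Z. (case z of (t, v) \<Rightarrow> half_collapse t v) \<in> (\<lambda>x. Some (plane_vec x)) ` W}
      = ?j ` ({p \<in> ?Dom. ?hp p \<in> W} \<inter> ?I \<times> UNIV)" (is "?L W = ?R W") for W
  proof (intro subset_antisym subsetI)
    fix z assume "z \<in> ?L W"
    then obtain t v where tv: "t \<in> ?I" "z = (t, v)" "v = None \<or> (\<exists>x. v = Some (plane_vec x))"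
      and "half_collapse t v \<in> (\<lambda>x. Some (plane_vec x)) ` W"
      unfolding mem_Collect_eq pre by auto
    then obtain x where x: "v = Some (plane_vec x)" "Re (rot t * x) < 0" "half_plane_map t x \<in> W"
      by (auto simp: sphere_chart_inj[OF sphere_chart_plane] simp del: times_complex.sel
          split: if_splits)
    then have "(t, x) \<in> {p \<in> ?Dom. ?hp p \<in> W} \<inter> ?I \<times> UNIV"
      using tv by simp
    then have "?j (t, x) \<in> ?R W" by (rule imageI)
    then show "z \<in> ?R W" using tv x by simp
  next
    fix z assume "z \<in> ?R W"
    then show "z \<in> ?L W" unfolding mem_Collect_eq pre by auto
  qed
  show "(case z of (t, v) \<Rightarrow> half_collapse t v) \<in> insert None (range (\<lambda>x. Some (plane_vec x)))"
    if "z \<in> topspace ?Z" for z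
    using that unfolding pre by auto
  show "openin ?Z (?L W)" if "open W" for W
  proof -
    have dom: "open ?Dom" by (intro open_Collect_less continuous_intros)
    have "continuous_on ?Dom ?hp"
      unfolding half_plane_map_def by (intro continuous_intros) auto
    then have "open (?Dom \<inter> ?hp -` W)"
      using dom that by (rule continuous_open_preimage)
    then have "openin (top_of_set (?I \<times> UNIV)) ({p \<in> ?Dom. ?hp p \<in> W} \<inter> ?I \<times> UNIV)"
      by (intro openin_subtopology_Int) (simp add: Int_def vimage_def)
    then have "openin (prod_topology (top_of_set ?I) (euclidean :: complex topology))
        ({p \<in> ?Dom. ?hp p \<in> W} \<inter> ?I \<times> UNIV)"
      by (simp only: IZ)
    moreover have "open_map euclidean ?S (\<lambda>x. Some (plane_vec x))"
      using sphere_chart_open[OF sphere_chart_plane] by (simp add: open_map_def)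
    moreover have "open_map (top_of_set ?I) (top_of_set ?I) (\<lambda>t. t)" by (simp add: open_map_def)
    ultimately show ?thesis unfolding eq1 by (intro openin_prod_image)
  qed
  show "closedin ?Z (?L C)" if C: "compact C" for C
  proof -
    let ?k = "\<lambda>(t, u). (t, Some (plane_vec (half_plane_inv t u)))"
    \<comment> \<open>The inverse involves only \<open>exp\<close> and is continuous for all
      \<open>t\<close> and \<open>u\<close>, so the preimage of \<open>C\<close> is a continuous
      image of the compact set \<open>?I \<times> C\<close>.\<close>
    have eq2: "?L C = ?k ` (?I \<times> C)"
    proof -
      have "{p \<in> ?Dom. ?hp p \<in> C} \<inter> ?I \<times> UNIV = (\<lambda>(t, u). (t, half_plane_inv t u)) ` (?I \<times> C)"
      proof (intro subset_antisym subsetI)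
        fix p assume p: "p \<in> {p \<in> ?Dom. ?hp p \<in> C} \<inter> ?I \<times> UNIV"
        then have "p = (\<lambda>(t, u). (t, half_plane_inv t u)) (fst p, ?hp p)"
          by (simp add: half_plane_inverse(3) prod_eq_iff del: times_complex.sel)
        moreover have "(fst p, ?hp p) \<in> ?I \<times> C" using p by auto
        ultimately show "p \<in> (\<lambda>(t, u). (t, half_plane_inv t u)) ` (?I \<times> C)" by (rule image_eqI)
      qed (auto simp: half_plane_inverse simp del: times_complex.sel)
      then show ?thesis unfolding eq1 by (simp add: image_image case_prod_unfold)
    qed
    have "continuous_on (?I \<times> UNIV) (\<lambda>p. half_plane_inv (fst p) (snd p))"
      unfolding half_plane_inv_def by (intro continuous_intros)
    then have "continuous_map (prod_topology (top_of_set ?I) euclidean) euclidean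
        (\<lambda>p. half_plane_inv (fst p) (snd p))"
      by (simp only: IZ continuous_map_iff_continuous)
    from continuous_map_compose[OF this sphere_chart_continuous[OF sphere_chart_plane]]
    have "continuous_map (prod_topology (top_of_set ?I) euclidean) ?Z ?k"
      by (simp add: case_prod_unfold continuous_map_pairedI continuous_map_fst o_def)
    moreover have "compactin (prod_topology (top_of_set ?I) euclidean) (?I \<times> C)"
      using C by (simp add: compactin_Times compactin_subtopology)
    ultimately have "compactin ?Z (?L C)"
      unfolding eq2 by (intro image_compactin)
    moreover have "Hausdorff_space ?Z"
      using Hausdorff_space_sphere[OF sphere_chart_plane]
      by (simp add: Hausdorff_space_prod_topology Hausdorff_space_subtopology)
    ultimately show ?thesis by (simp add: compactin_imp_closedin)
  qed
qed

section \<open>Symmetries of the plane and the complementary half-plane\<close>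

definition sphere_neg :: "vec option \<Rightarrow> vec option" where
  "sphere_neg = map_option (\<lambda>(x, y). (\<lambda>i. - x i, \<lambda>i. - y i))"

text \<open>On the plane this is \<open>- cnj z\<close>: it undoes a previous
  \<open>sphere_neg\<close> and applies the action in one step.\<close>

definition sphere_reflect :: "vec option \<Rightarrow> vec option" where
  "sphere_reflect = map_option (\<lambda>(x, y). (\<lambda>i. - x i, y))"

lemma coord0_uminus: "coord0 (- t) = (\<lambda>i. - coord0 t i)"
  by (auto simp: coord0_def)

lemma sphere_neg_simps [simp]: "sphere_neg None = None"
  "sphere_neg (Some (plane_vec z)) = Some (plane_vec (- z))"
  by (auto simp: sphere_neg_def plane_vec_def coord0_uminus)

lemma sphere_reflect_simps [simp]: "sphere_reflect None = None"
  "sphere_reflect (Some (plane_vec z)) = Some (plane_vec (- cnj z))"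
  by (auto simp: sphere_reflect_def plane_vec_def coord0_uminus)

lemma continuous_map_sphere_neg:
  "continuous_map (gtop (rep_sphere (1, 1))) (gtop (rep_sphere (1, 1))) sphere_neg"
  by (rule continuous_map_sphere_homeo[OF sphere_chart_plane sphere_chart_plane,
        where \<phi> = uminus and \<psi> = uminus]) (auto intro!: continuous_intros)

lemma continuous_map_sphere_reflect:
  "continuous_map (gtop (rep_sphere (1, 1))) (gtop (rep_sphere (1, 1))) sphere_reflect"
  by (rule continuous_map_sphere_homeo[OF sphere_chart_plane sphere_chart_plane,
        where \<phi> = "\<lambda>z. - cnj z" and \<psi> = "\<lambda>z. - cnj z"]) (auto intro!: continuous_intros)

text \<open>The collapse of the half-plane complementary to that of \<open>half_collapse\<close>, followed by the
  action on \<open>S\<^sup>1\<^sup>+\<^sup>\<alpha>\<close>.\<close>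

definition half_collapse' :: "real \<Rightarrow> vec option \<Rightarrow> vec option" where
  "half_collapse' t v = sphere_reflect (half_collapse t (sphere_neg v))"

lemma half_collapse'_simps [simp]:
  "half_collapse' t None = None"
  "half_collapse' t (Some (plane_vec z)) = (if Re (rot t * z) > 0 then
     Some (plane_vec (cnj (cnj (rot t) * Complex (ln (Re (rot t * z))) (Im (rot t * z))))) else None)"
proof -
  have "half_plane_map t (- z) = - (cnj (rot t) * Complex (ln (Re (rot t * z))) (Im (rot t * z)))"
    by (simp add: half_plane_map_def complex_eq_iff algebra_simps)
  then show "half_collapse' t (Some (plane_vec z)) = (if Re (rot t * z) > 0 then
     Some (plane_vec (cnj (cnj (rot t) * Complex (ln (Re (rot t * z))) (Im (rot t * z))))) else None)"
    by (simp add: half_collapse'_def del: times_complex.sel)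
qed (simp add: half_collapse'_def)

lemma continuous_map_half_collapse':
  "continuous_map (prod_topology (top_of_set {0..1}) (gtop (rep_sphere (1, 1))))
     (gtop (rep_sphere (1, 1))) (\<lambda>(t, v). half_collapse' t v)"
proof -
  let ?S = "gtop (rep_sphere (1, 1))"
  have "continuous_map (prod_topology (top_of_set {0..1::real}) ?S) (prod_topology (top_of_set {0..1}) ?S)
      (\<lambda>(t, v). (t, sphere_neg v))"
    by (simp only: continuous_map_prod_top continuous_map_sphere_neg continuous_map_id[unfolded id_def] simp_thms)
  from continuous_map_compose[OF continuous_map_compose[OF this continuous_map_half_collapse]
      continuous_map_sphere_reflect]
  show ?thesis by (simp add: o_def half_collapse'_def case_prod_unfold)
qed

lemma half_collapse_disjoint:
  "v \<in> topspace (gtop (rep_sphere (1, 1))) \<Longrightarrow> half_collapse t v = None \<or> half_collapse' t v = None"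
  unfolding sphere_chart_topspace[OF sphere_chart_plane] by auto

text \<open>The sum of \<open>m\<close> and its conjugate \<open>\<sigma> \<circ> m \<circ> cnj\<close>, concatenated along the trivial coordinate
  for \<open>t = 0\<close> and along the sign coordinate for \<open>t = 1\<close>.\<close>

definition rot_sum :: "('a \<Rightarrow> 'a) \<Rightarrow> real \<Rightarrow> (vec option \<Rightarrow> 'a) \<Rightarrow> vec option \<Rightarrow> 'a" where
  "rot_sum \<sigma> t m = (\<lambda>v\<in>topspace (gtop (rep_sphere (1, 1))).
     if half_collapse' t v = None then m (half_collapse t v) else \<sigma> (m (half_collapse' t v)))"

lemma continuous_map_rot_sum:
  assumes F: "pointed_gspace F"
  defines "M \<equiv> gtop (loops (1, 1) F)"
  shows "continuous_map (prod_topology (top_of_set {0..1}) M) M (\<lambda>(t, m). rot_sum (gact F) t m)"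
  unfolding M_def loops_def
proof (rule continuous_map_into_gmap)
  let ?S = "gtop (rep_sphere (1, 1))" and ?I = "top_of_set {0..1::real}"
  let ?M = "gtop (gmap (rep_sphere (1, 1)) F)"
  let ?Z = "prod_topology (prod_topology ?I ?M) ?S"
  have S: "compact_space ?S" "Hausdorff_space ?S"
    using compact_space_sphere Hausdorff_space_sphere sphere_chart_plane by blast+
  have proj: "continuous_map ?Z ?M (\<lambda>z. snd (fst z))"
    "continuous_map ?Z (prod_topology ?I ?S) (\<lambda>z. (fst (fst z), snd z))"
    by (simp_all add: continuous_map_pairedI continuous_map_snd continuous_map_of_fst
        continuous_map_of_snd continuous_map_fst_of continuous_map_snd_of continuous_map_fst
        continuous_map_compose[OF continuous_map_fst continuous_map_fst, unfolded o_def]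
        continuous_map_compose[OF continuous_map_fst continuous_map_snd, unfolded o_def])
  have c0: "continuous_map ?Z ?S (\<lambda>z. half_collapse (fst (fst z)) (snd z))"
    using continuous_map_compose[OF proj(2) continuous_map_half_collapse] by (simp add: o_def)
  have c1: "continuous_map ?Z ?S (\<lambda>z. half_collapse' (fst (fst z)) (snd z))"
    using continuous_map_compose[OF proj(2) continuous_map_half_collapse'] by (simp add: o_def)
  have f0: "continuous_map ?Z (gtop F) (\<lambda>z. snd (fst z) (half_collapse (fst (fst z)) (snd z)))"
    by (rule continuous_map_gmap_eval[OF S proj(1) c0])
  have "continuous_map ?Z (gtop F) (\<lambda>z. snd (fst z) (half_collapse' (fst (fst z)) (snd z)))"
    by (rule continuous_map_gmap_eval[OF S proj(1) c1])
  moreover have "continuous_map (gtop F) (gtop F) (gact F)" using F by (simp add: pointed_gspace_def)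
  ultimately have f1: "continuous_map ?Z (gtop F)
      (\<lambda>z. gact F (snd (fst z) (half_collapse' (fst (fst z)) (snd z))))"
    using continuous_map_compose[of ?Z "gtop F" _ "gtop F" "gact F"] by (simp add: o_def)
  have base: "closedin ?S {None}"
    using S(2) Hausdorff_imp_t1_space t1_space_closedin_singleton
    by (metis insertI1 sphere_chart_plane sphere_chart_topspace)
  let ?g = "\<lambda>z. if half_collapse' (fst (fst z)) (snd z) = None
       then snd (fst z) (half_collapse (fst (fst z)) (snd z))
       else gact F (snd (fst z) (half_collapse' (fst (fst z)) (snd z)))"
  have "continuous_map ?Z (gtop F) ?g"
  \<comment> \<open>The two closed pieces are the sets where one of the collapses is at infinity;
    they cover everything because the two open half-planes are disjoint.\<close>
  proof (rule pasting_lemma_closed[where I = "UNIV :: bool set" and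
        T = "\<lambda>b. if b then {z \<in> topspace ?Z. half_collapse' (fst (fst z)) (snd z) \<in> {None}}
                else {z \<in> topspace ?Z. half_collapse (fst (fst z)) (snd z) \<in> {None}}" and
        f = "\<lambda>b. if b then (\<lambda>z. snd (fst z) (half_collapse (fst (fst z)) (snd z)))
                else (\<lambda>z. gact F (snd (fst z) (half_collapse' (fst (fst z)) (snd z))))"])
    have "closedin ?Z {z \<in> topspace ?Z. half_collapse' (fst (fst z)) (snd z) \<in> {None}}"
      by (rule closedin_continuous_map_preimage[OF c1 base])
    moreover have "closedin ?Z {z \<in> topspace ?Z. half_collapse (fst (fst z)) (snd z) \<in> {None}}"
      by (rule closedin_continuous_map_preimage[OF c0 base])
    ultimately show "closedin ?Z (if b then {z \<in> topspace ?Z. half_collapse' (fst (fst z)) (snd z) \<in> {None}}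
                else {z \<in> topspace ?Z. half_collapse (fst (fst z)) (snd z) \<in> {None}})" for b
      by simp
  next
    fix b
    show "continuous_map (subtopology ?Z (if b then {z \<in> topspace ?Z. half_collapse' (fst (fst z)) (snd z) \<in> {None}}
                else {z \<in> topspace ?Z. half_collapse (fst (fst z)) (snd z) \<in> {None}})) (gtop F)
        (if b then (\<lambda>z. snd (fst z) (half_collapse (fst (fst z)) (snd z)))
                else (\<lambda>z. gact F (snd (fst z) (half_collapse' (fst (fst z)) (snd z)))))"
      using f0 f1 by (cases b) (simp_all add: continuous_map_from_subtopology)
  next
    \<comment> \<open>On the overlap both collapses are at infinity, where a pointed loop takes the
      base point, which is fixed by the action.\<close>
    have bp: "snd (fst z) None = gbase F" if "z \<in> topspace ?Z" for z
      using that by (auto simp: topspace_gmap)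
    have "gact F (gbase F) = gbase F" using F by (simp add: pointed_gspace_def)
    with bp show "(if i then (\<lambda>z. snd (fst z) (half_collapse (fst (fst z)) (snd z)))
                else (\<lambda>z. gact F (snd (fst z) (half_collapse' (fst (fst z)) (snd z))))) x =
           (if j then (\<lambda>z. snd (fst z) (half_collapse (fst (fst z)) (snd z)))
                else (\<lambda>z. gact F (snd (fst z) (half_collapse' (fst (fst z)) (snd z))))) x"
      if "x \<in> topspace ?Z \<inter>
            (if i then {z \<in> topspace ?Z. half_collapse' (fst (fst z)) (snd z) \<in> {None}}
                else {z \<in> topspace ?Z. half_collapse (fst (fst z)) (snd z) \<in> {None}}) \<inter>
            (if j then {z \<in> topspace ?Z. half_collapse' (fst (fst z)) (snd z) \<in> {None}}
                else {z \<in> topspace ?Z. half_collapse (fst (fst z)) (snd z) \<in> {None}})" for i j x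
      using that by (cases i; cases j) simp_all
  next
    fix z assume z: "z \<in> topspace ?Z"
    then have "snd z \<in> topspace ?S" by auto
    from half_collapse_disjoint[OF this, of "fst (fst z)"] z
    show "\<exists>j. j \<in> UNIV \<and>
        z \<in> (if j then {z \<in> topspace ?Z. half_collapse' (fst (fst z)) (snd z) \<in> {None}}
                else {z \<in> topspace ?Z. half_collapse (fst (fst z)) (snd z) \<in> {None}}) \<and>
        ?g z = (if j then (\<lambda>z. snd (fst z) (half_collapse (fst (fst z)) (snd z)))
                else (\<lambda>z. gact F (snd (fst z) (half_collapse' (fst (fst z)) (snd z))))) z"
      by (intro exI[of _ "half_collapse' (fst (fst z)) (snd z) = None"]) auto
  qed simp
  then show "continuous_map ?Z (gtop F) (\<lambda>(z, v). ?g (z, v))"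
    by (simp only: case_prod_unfold prod.collapse)
  show "(case z of (t, m) \<Rightarrow> rot_sum (gact F) t m) v = ?g (z, v)" if "v \<in> topspace ?S" for z v
    using that by (simp add: rot_sum_def case_prod_unfold)
  show "(case z of (t, m) \<Rightarrow> rot_sum (gact F) t m) \<in> extensional (topspace ?S)" for z
    by (simp add: rot_sum_def case_prod_unfold)
  show "(case z of (t, m) \<Rightarrow> rot_sum (gact F) t m) (gbase (rep_sphere (1, 1))) = gbase F"
    if "z \<in> topspace (prod_topology ?I ?M)" for z
    using that by (auto simp: rot_sum_def topspace_gmap sphere_chart_topspace[OF sphere_chart_plane] simp del: One_nat_def)
qed

section \<open>The two orders of looping\<close>

lemma topspace_loops:
  "topspace (gtop (loops U X)) = {f \<in> extensional (topspace (gtop (rep_sphere U))).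
     continuous_map (gtop (rep_sphere U)) (gtop X) f \<and> f None = gbase X}"
  by (simp add: loops_def topspace_gmap)

lemma gbase_loops: "gbase (loops U X) = (\<lambda>_\<in>topspace (gtop (rep_sphere U)). gbase X)"
  by (simp add: loops_def gmap_def)

lemma gact_loops:
  "gact (loops U X) f = (\<lambda>s\<in>topspace (gtop (rep_sphere U)). gact X (f (gact (rep_sphere U) s)))"
  by (simp add: loops_def gmap_def)

lemma gact_rep_sphere_simps [simp]:
  "gact (rep_sphere U) None = None"
  "gact (rep_sphere U) (Some (line_vec t)) = Some (line_vec t)"
  "gact (rep_sphere U) (Some (sign_vec t)) = Some (sign_vec (- t))"
  by (simp_all add: rep_sphere_def line_vec_def sign_vec_def coord0_uminus)

lemmas topspace_line = sphere_chart_topspace[OF sphere_chart_line]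
lemmas topspace_sign = sphere_chart_topspace[OF sphere_chart_sign]
lemmas topspace_plane = sphere_chart_topspace[OF sphere_chart_plane]

lemma gact_loops_one_in:
  assumes X: "pointed_gspace X" and f: "f \<in> topspace (gtop (loops rep_one X))"
  shows "gact (loops rep_one X) f \<in> topspace (gtop (loops rep_one X))"
proof -
  let ?S = "gtop (rep_sphere rep_one)"
  \<comment> \<open>The action on the sphere of the trivial representation is trivial, so
    conjugation is mere postcomposition.\<close>
  have "continuous_map ?S (gtop X) (gact X \<circ> f)"
    using f X by (auto simp: topspace_loops pointed_gspace_def intro: continuous_map_compose)
  then have "continuous_map ?S (gtop X) (gact (loops rep_one X) f)"
    by (rule continuous_map_eq) (auto simp: gact_loops topspace_line simp del: One_nat_def)
  moreover have "gact (loops rep_one X) f None = gbase X"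
    using f X by (simp add: gact_loops topspace_line topspace_loops pointed_gspace_def del: One_nat_def)
  ultimately show ?thesis by (simp add: topspace_loops) (simp add: gact_loops)
qed

section \<open>Pointed equivariant homeomorphisms and their inverses\<close>

lemma pointed_ghomeo_simps:
  assumes "pointed_ghomeo X Y h"
  shows pointed_ghomeo_continuous: "continuous_map (gtop X) (gtop Y) h"
    and pointed_ghomeo_inj: "\<lbrakk>x \<in> topspace (gtop X); x' \<in> topspace (gtop X); h x = h x'\<rbrakk> \<Longrightarrow> x = x'"
    and pointed_ghomeo_in: "x \<in> topspace (gtop X) \<Longrightarrow> h x \<in> topspace (gtop Y)"
    and pointed_ghomeo_base: "h (gbase X) = gbase Y"
    and pointed_ghomeo_gact: "x \<in> topspace (gtop X) \<Longrightarrow> h (gact X x) = gact Y (h x)"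
    and pointed_ghomeo_inv_in: "y \<in> topspace (gtop Y) \<Longrightarrow> inv_into (topspace (gtop X)) h y \<in> topspace (gtop X)"
    and pointed_ghomeo_inv_right: "y \<in> topspace (gtop Y) \<Longrightarrow> h (inv_into (topspace (gtop X)) h y) = y"
    and pointed_ghomeo_inv_left: "x \<in> topspace (gtop X) \<Longrightarrow> inv_into (topspace (gtop X)) h (h x) = x"
    and pointed_ghomeo_inv_continuous: "continuous_map (gtop Y) (gtop X) (inv_into (topspace (gtop X)) h)"
proof -
  have h: "homeomorphic_map (gtop X) (gtop Y) h" using assms by (simp add: pointed_ghomeo_def)
  have inj: "inj_on h (topspace (gtop X))" using h homeomorphic_imp_injective_map by blast
  have surj: "h ` topspace (gtop X) = topspace (gtop Y)" using h homeomorphic_imp_surjective_map by blast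
  show "continuous_map (gtop X) (gtop Y) h" using h homeomorphic_imp_continuous_map by blast
  show "\<lbrakk>x \<in> topspace (gtop X); x' \<in> topspace (gtop X); h x = h x'\<rbrakk> \<Longrightarrow> x = x'"
    using inj by (auto dest: inj_onD)
  show "x \<in> topspace (gtop X) \<Longrightarrow> h x \<in> topspace (gtop Y)" using surj by blast
  show "h (gbase X) = gbase Y" "x \<in> topspace (gtop X) \<Longrightarrow> h (gact X x) = gact Y (h x)"
    using assms by (auto simp: pointed_ghomeo_def)
  show *: "y \<in> topspace (gtop Y) \<Longrightarrow> inv_into (topspace (gtop X)) h y \<in> topspace (gtop X)" for y
    using surj by (metis inv_into_into)
  show **: "y \<in> topspace (gtop Y) \<Longrightarrow> h (inv_into (topspace (gtop X)) h y) = y" for y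
    using surj by (metis f_inv_into_f)
  show "x \<in> topspace (gtop X) \<Longrightarrow> inv_into (topspace (gtop X)) h (h x) = x"
    using inj by simp
  \<comment> \<open>\<open>deloop\<close> is an \<open>inv_into\<close>; it inherits continuity from
    the topological inverse, with which it agrees on the space.\<close>
  obtain g where g: "homeomorphic_maps (gtop X) (gtop Y) h g"
    using h homeomorphic_map_maps by blast
  then have "continuous_map (gtop Y) (gtop X) g" by (simp add: homeomorphic_maps_def)
  moreover have "g y = inv_into (topspace (gtop X)) h y" if "y \<in> topspace (gtop Y)" for y
  proof -
    have "g (h (inv_into (topspace (gtop X)) h y)) = inv_into (topspace (gtop X)) h y"
      using g *[OF that] by (simp add: homeomorphic_maps_def)
    then show ?thesis by (simp add: **[OF that])
  qed
  ultimately show "continuous_map (gtop Y) (gtop X) (inv_into (topspace (gtop X)) h)"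
    by (rule continuous_map_eq)
qed

lemma pointed_ghomeo_deloop_gact:
  assumes h: "pointed_ghomeo (loops rep_one X) Y h" and X: "pointed_gspace X"
    and y: "y \<in> topspace (gtop Y)"
  shows "inv_into (topspace (gtop (loops rep_one X))) h (gact Y y) =
    gact (loops rep_one X) (inv_into (topspace (gtop (loops rep_one X))) h y)"
proof -
  let ?l = "inv_into (topspace (gtop (loops rep_one X))) h y"
  have l: "?l \<in> topspace (gtop (loops rep_one X))" by (rule pointed_ghomeo_inv_in[OF h y])
  have "h (gact (loops rep_one X) ?l) = gact Y y"
    unfolding pointed_ghomeo_gact[OF h l] pointed_ghomeo_inv_right[OF h y] ..
  then show ?thesis
    using pointed_ghomeo_inv_left[OF h gact_loops_one_in[OF X l]] by simp
qed

text \<open>Half of the adjunction between loops on a smash product and iterated loops. Both the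
  inner and the outer loop are pointed because smashing with infinity on either side gives
  infinity.\<close>

lemma curried_loop:
  assumes sm: "continuous_map (prod_topology (gtop (rep_sphere U)) (gtop (rep_sphere U')))
      (gtop (rep_sphere W)) (\<lambda>(s, s'). sphere_smash U s s')"
    and h: "pointed_ghomeo (loops U' X) Y h"
    and f: "f \<in> topspace (gtop (loops W X))"
  shows "s \<in> topspace (gtop (rep_sphere U)) \<Longrightarrow>
      (\<lambda>s'\<in>topspace (gtop (rep_sphere U')). f (sphere_smash U s s')) \<in> topspace (gtop (loops U' X))"
    and "(\<lambda>s\<in>topspace (gtop (rep_sphere U)). h (\<lambda>s'\<in>topspace (gtop (rep_sphere U')).
      f (sphere_smash U s s'))) \<in> topspace (gtop (loops U Y))"
proof -
  let ?c = "\<lambda>s. \<lambda>s'\<in>topspace (gtop (rep_sphere U')). f (sphere_smash U s s')"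
  have None_in: "None \<in> topspace (gtop (rep_sphere U))" for U
    by (simp add: rep_sphere_def)
  have f0: "f None = gbase X" using f by (simp add: topspace_loops)
  have "continuous_map (prod_topology (gtop (rep_sphere U)) (gtop (rep_sphere U'))) (gtop X)
      (f \<circ> (\<lambda>(s, s'). sphere_smash U s s'))"
    using sm f by (auto simp: topspace_loops intro: continuous_map_compose)
  then have c: "continuous_map (gtop (rep_sphere U)) (gtop (loops U' X)) ?c"
    unfolding loops_def
    by (intro continuous_map_into_gmap[where g = "\<lambda>s s'. f (sphere_smash U s s')"])
      (auto simp: f0 None_in o_def case_prod_unfold)
  then show "s \<in> topspace (gtop (rep_sphere U)) \<Longrightarrow> ?c s \<in> topspace (gtop (loops U' X))"
    using continuous_map_image_subset_topspace by fastforce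
  have "continuous_map (gtop (rep_sphere U)) (gtop Y) (h \<circ> ?c)"
    using c pointed_ghomeo_continuous[OF h] by (rule continuous_map_compose)
  then have "continuous_map (gtop (rep_sphere U)) (gtop Y) (restrict (h \<circ> ?c) (topspace (gtop (rep_sphere U))))"
    by (rule continuous_map_eq) auto
  moreover have "h (?c None) = gbase Y"
    using pointed_ghomeo_base[OF h] by (simp add: f0 gbase_loops)
  ultimately show "(\<lambda>s\<in>topspace (gtop (rep_sphere U)). h (?c s)) \<in> topspace (gtop (loops U Y))"
    by (simp add: topspace_loops None_in o_def)
qed

lemma rot_sum_in:
  assumes "pointed_gspace F" "t \<in> {0..1}" "m \<in> topspace (gtop (loops (1, 1) F))"
  shows "rot_sum (gact F) t m \<in> topspace (gtop (loops (1, 1) F))"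
  using continuous_map_image_subset_topspace[OF continuous_map_rot_sum[OF assms(1)]] assms(2,3)
  by (auto simp: image_subset_iff simp del: One_nat_def)

lemma rot_sum_None:
  "rot_sum \<sigma> t m None = m None"
  by (simp add: rot_sum_def topspace_plane del: One_nat_def)

lemma rot_sum_0:
  "rot_sum \<sigma> 0 m (Some (plane_vec (Complex u b))) =
    (if u < 0 then m (Some (plane_vec (Complex (- ln (- u)) b)))
     else if u > 0 then \<sigma> (m (Some (plane_vec (Complex (ln u) (- b))))) else m None)"
  by (auto simp: rot_sum_def topspace_plane half_plane_map_def complex_cnj simp del: One_nat_def)

text \<open>Unlike at time 0, conjugation now reflects the very coordinate along which the halves
  are joined. This produces the minus sign before \<open>ln b\<close>, which is the reversal built
  into \<open>pinch\<close>.\<close>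

lemma rot_sum_1:
  "rot_sum \<sigma> 1 m (Some (plane_vec (Complex u b))) =
    (if b < 0 then m (Some (plane_vec (Complex u (- ln (- b)))))
     else if b > 0 then \<sigma> (m (Some (plane_vec (Complex u (- ln b))))) else m None)"
proof -
  have *: "half_plane_map 1 (Complex u b) = Complex u (- ln (- b))"
    "cnj (\<i> * Complex (ln b) (- u)) = Complex u (- ln b)"
    by (simp_all add: half_plane_map_def complex_eq_iff)
  show ?thesis
    using * by (auto simp: rot_sum_def topspace_plane simp del: One_nat_def complex_cnj_mult)
qed

lemma fst_line_vec: "fst (line_vec u) 0 = u"
  by (simp add: line_vec_def)

lemma loop_concat_simps [simp]:
  "loop_concat f g None = f None"
  "loop_concat f g (Some (line_vec u)) =
    (if u < 0 then f (Some (line_vec (- ln (- u)))) else if u > 0 then g (Some (line_vec (ln u))) else f None)"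
  by (simp_all add: loop_concat_def topspace_line line_pt_eq fst_line_vec Let_def del: One_nat_def)

lemma loop_concat_extensional: "loop_concat f g \<in> extensional (topspace (gtop (rep_sphere rep_one)))"
  by (simp add: loop_concat_def)

lemma loop_reverse_simps [simp]:
  "loop_reverse f None = f None"
  "loop_reverse f (Some (line_vec u)) = f (Some (line_vec (- u)))"
  by (simp_all add: loop_reverse_def topspace_line line_pt_eq fst_line_vec del: One_nat_def)

text \<open>For a real spectrum these are \<open>F = E\<^bsub>1+V\<^esub>\<close>, \<open>X = E\<^bsub>V\<^esub>\<close>, \<open>G = E\<^bsub>1+V-\<alpha>\<^esub>\<close>, \<open>Y = E\<^bsub>V-\<alpha>\<^esub>\<close>, so
  that \<open>Y\<close> is the double loop space \<open>\<Omega>\<^sup>1\<^sup>+\<^sup>\<alpha>F\<close> in two ways.\<close>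

locale double_loops =
  fixes F X G Y :: "'a gspace"
    and k\<^sub>1 k\<^sub>\<alpha> r\<^sub>1 s\<^sub>\<alpha> :: "(vec option \<Rightarrow> 'a) \<Rightarrow> 'a" and K :: "(vec option \<Rightarrow> 'a) \<Rightarrow> 'a"
  assumes F: "pointed_gspace F" and X: "pointed_gspace X" and G: "pointed_gspace G"
    and k\<^sub>1: "pointed_ghomeo (loops rep_one F) X k\<^sub>1"
    and k\<^sub>\<alpha>: "pointed_ghomeo (loops rep_alpha F) G k\<^sub>\<alpha>"
    and r\<^sub>1: "pointed_ghomeo (loops rep_one G) Y r\<^sub>1"
    and s\<^sub>\<alpha>: "pointed_ghomeo (loops rep_alpha X) Y s\<^sub>\<alpha>"
    and K: "pointed_ghomeo (loops (1, 1) F) Y K"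
    and K_one_alpha: "\<And>m. m \<in> topspace (gtop (loops (1, 1) F)) \<Longrightarrow>
      K m = r\<^sub>1 (\<lambda>s\<in>topspace (gtop (rep_sphere rep_one)).
        k\<^sub>\<alpha> (\<lambda>a\<in>topspace (gtop (rep_sphere rep_alpha)). m (sphere_smash rep_one s a)))"
    and K_alpha_one: "\<And>m. m \<in> topspace (gtop (loops (1, 1) F)) \<Longrightarrow>
      K m = s\<^sub>\<alpha> (\<lambda>a\<in>topspace (gtop (rep_sphere rep_alpha)).
        k\<^sub>1 (\<lambda>s\<in>topspace (gtop (rep_sphere rep_one)). m (sphere_smash rep_alpha a s)))"
begin

lemma gact_base: "gact F (gbase F) = gbase F"
  using F by (simp add: pointed_gspace_def)

text \<open>With the trivial coordinate outermost, joining half-planes at time 0 is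
  \<open>loop_concat\<close> of outer loops, and the reflection of the sign coordinate stays inside
  the inner loop, where it is part of the action on \<open>G\<close>.\<close>

lemma one_sum:
  assumes m: "m \<in> topspace (gtop (loops (1, 1) F))"
  defines "dl \<equiv> inv_into (topspace (gtop (loops rep_one G))) r\<^sub>1"
  shows "r\<^sub>1 (loop_concat (dl (K m)) (dl (gact Y (K m)))) = K (rot_sum (gact F) 0 m)"
proof -
  let ?S = "topspace (gtop (rep_sphere rep_one))" and ?A = "topspace (gtop (rep_sphere rep_alpha))"
  let ?m' = "rot_sum (gact F) 0 m"
  let ?c = "\<lambda>m s. \<lambda>a\<in>?A. m (sphere_smash rep_one s a)"
  let ?n = "\<lambda>s\<in>?S. k\<^sub>\<alpha> (?c m s)"
  have m0: "m None = gbase F" using m by (simp add: topspace_loops)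
  have m': "?m' \<in> topspace (gtop (loops (1, 1) F))" using rot_sum_in[OF F _ m] by simp
  have n: "?n \<in> topspace (gtop (loops rep_one G))"
    by (rule curried_loop(2)[OF continuous_map_smash_one_alpha k\<^sub>\<alpha> m])
  have c: "?c m s \<in> topspace (gtop (loops rep_alpha F))" if "s \<in> ?S" for s
    by (rule curried_loop(1)[OF continuous_map_smash_one_alpha k\<^sub>\<alpha> m that])
  have dn: "dl (K m) = ?n"
    unfolding dl_def K_one_alpha[OF m] by (rule pointed_ghomeo_inv_left[OF r\<^sub>1 n])
  have Km: "K m \<in> topspace (gtop Y)" by (rule pointed_ghomeo_in[OF K m])
  have dg: "dl (gact Y (K m)) = gact (loops rep_one G) ?n"
    using pointed_ghomeo_deloop_gact[OF r\<^sub>1 G Km] dn by (simp add: dl_def)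
  have base: "k\<^sub>\<alpha> (\<lambda>a\<in>?A. gbase F) = gbase G"
    using pointed_ghomeo_base[OF k\<^sub>\<alpha>] by (simp add: gbase_loops)
  have neg: "?c ?m' (Some (line_vec u)) = ?c m (Some (line_vec (- ln (- u))))" if "u < 0" for u
    by (rule restrict_ext)
      (use that in \<open>auto simp: topspace_sign sphere_smash_line_sign rot_sum_None rot_sum_0
        simp del: One_nat_def sphere_smash.simps(1)\<close>)
  have pos: "?c ?m' (Some (line_vec u)) = gact (loops rep_alpha F) (?c m (Some (line_vec (ln u))))"
    if "u > 0" for u
    unfolding gact_loops
    by (rule restrict_ext)
      (use that in \<open>auto simp: topspace_sign sphere_smash_line_sign rot_sum_None rot_sum_0 m0 gact_base
          sphere_chart_inj[OF sphere_chart_sign]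
        simp del: One_nat_def sphere_smash.simps(1)\<close>)
  \<comment> \<open>On the dividing line the inner loop is constant at the base point, in agreement
    with the default value \<open>f None\<close> of \<open>loop_concat\<close>.\<close>
  have zero: "?c ?m' (Some (line_vec 0)) = (\<lambda>a\<in>?A. gbase F)"
    by (rule restrict_ext)
      (auto simp: topspace_sign sphere_smash_line_sign rot_sum_None rot_sum_0 m0
        simp del: One_nat_def sphere_smash.simps(1))
  have none: "?c f None = (\<lambda>a\<in>?A. f None)" for f :: "vec option \<Rightarrow> 'a" by simp
  have "(\<lambda>s\<in>?S. k\<^sub>\<alpha> (?c ?m' s)) = loop_concat ?n (gact (loops rep_one G) ?n)"
  proof (rule extensionalityI[where A = ?S])
    have n0: "?n None = gbase G" using n by (simp add: topspace_loops)
    have l: "Some (line_vec u) \<in> ?S" for u by (simp add: topspace_line del: One_nat_def)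
    have nl: "?n (Some (line_vec u)) = k\<^sub>\<alpha> (?c m (Some (line_vec u)))" for u
      using l by (rule restrict_apply')
    fix s assume s: "s \<in> ?S"
    then consider "s = None" | u where "s = Some (line_vec u)" "u < 0"
      | u where "s = Some (line_vec u)" "u > 0" | "s = Some (line_vec 0)"
      unfolding topspace_line by (auto simp: linorder_neq_iff) (metis linorder_neq_iff)
    then have "k\<^sub>\<alpha> (?c ?m' s) = loop_concat ?n (gact (loops rep_one G) ?n) s"
    proof cases
      case 1
      then show ?thesis by (simp only: none rot_sum_None m0 base loop_concat_simps n0)
    next
      case 2
      then show ?thesis by (simp only: neg loop_concat_simps nl if_True)
    next
      case 3
      \<comment> \<open>The action on the outer loop is that of \<open>G\<close> at each time;
        \<open>k\<^sub>\<alpha>\<close> is equivariant, so it amounts to conjugating the inner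
        loop.\<close>
      have "gact (loops rep_one G) ?n (Some (line_vec (ln u))) = gact G (k\<^sub>\<alpha> (?c m (Some (line_vec (ln u)))))"
        using l by (simp only: gact_loops restrict_apply' gact_rep_sphere_simps nl)
      also have "\<dots> = k\<^sub>\<alpha> (?c ?m' s)"
        using pointed_ghomeo_gact[OF k\<^sub>\<alpha> c[OF l]] 3 by (simp only: pos)
      finally show ?thesis using 3 by (simp only: loop_concat_simps not_less_iff_gr_or_eq if_True if_False) simp
    next
      case 4
      then show ?thesis by (simp only: zero base loop_concat_simps n0 less_irrefl if_False)
    qed
    then show "(\<lambda>s\<in>?S. k\<^sub>\<alpha> (?c ?m' s)) s = loop_concat ?n (gact (loops rep_one G) ?n) s"
      using s by (simp only: restrict_apply')
  qed (rule restrict_extensional loop_concat_extensional)+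
  then show ?thesis using K_one_alpha[OF m'] dn dg by simp
qed

text \<open>Now the sign coordinate is outermost. The assumption \<open>eq\<close> says that
  \<open>l\<close>, read as a loop in the sign direction, and \<open>m\<close> represent the same
  point of \<open>Y\<close>; the inner coordinate is trivial, so conjugation of inner loops becomes
  the action on \<open>X\<close>.\<close>

lemma pinch_sum:
  assumes m: "m \<in> topspace (gtop (loops (1, 1) F))"
    and l: "l \<in> topspace (gtop (loops rep_one X))"
    and l': "precomp (rep_sphere rep_alpha) alpha_to_one l \<in> topspace (gtop (loops rep_alpha X))"
    and eq: "s\<^sub>\<alpha> (precomp (rep_sphere rep_alpha) alpha_to_one l) = K m"
  defines "q \<equiv> precomp (rep_sphere rep_alpha) pinch (loop_pair l (gact (loops rep_one X) l))"
  shows "q \<in> topspace (gtop (loops rep_alpha X))" and "s\<^sub>\<alpha> q = K (rot_sum (gact F) 1 m)"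
proof -
  let ?S = "topspace (gtop (rep_sphere rep_one))" and ?A = "topspace (gtop (rep_sphere rep_alpha))"
  let ?m' = "rot_sum (gact F) 1 m"
  let ?c = "\<lambda>m a. \<lambda>s\<in>?S. m (sphere_smash rep_alpha a s)"
  let ?n = "\<lambda>m. \<lambda>a\<in>?A. k\<^sub>1 (?c m a)"
  have m0: "m None = gbase F" using m by (simp add: topspace_loops)
  have l0: "l None = gbase X" using l by (simp add: topspace_loops)
  have m': "?m' \<in> topspace (gtop (loops (1, 1) F))" using rot_sum_in[OF F _ m] by simp
  have n: "?n m \<in> topspace (gtop (loops rep_alpha X))" "?n ?m' \<in> topspace (gtop (loops rep_alpha X))"
    by (rule curried_loop(2)[OF continuous_map_smash_alpha_one k\<^sub>1], fact)+
  have c: "?c m a \<in> topspace (gtop (loops rep_one F))" if "a \<in> ?A" for a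
    by (rule curried_loop(1)[OF continuous_map_smash_alpha_one k\<^sub>1 m that])
  \<comment> \<open>Cancelling \<open>s\<^sub>\<alpha>\<close> turns an equality of points of
    \<open>Y\<close> into one of loops, so that each value of \<open>l\<close> is
    \<open>k\<^sub>1\<close> of a slice of \<open>m\<close>.\<close>
  have "s\<^sub>\<alpha> (?n m) = s\<^sub>\<alpha> (precomp (rep_sphere rep_alpha) alpha_to_one l)"
    using eq K_alpha_one[OF m] by simp
  then have nl: "?n m = precomp (rep_sphere rep_alpha) alpha_to_one l"
    using pointed_ghomeo_inj[OF s\<^sub>\<alpha> n(1) l'] by simp
  have a: "Some (sign_vec b) \<in> ?A" for b by (simp add: topspace_sign del: One_nat_def)
  have s: "Some (line_vec b) \<in> ?S" for b by (simp add: topspace_line del: One_nat_def)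
  have lb: "l (Some (line_vec b)) = k\<^sub>1 (?c m (Some (sign_vec b)))" for b
    using fun_cong[OF nl, of "Some (sign_vec b)"] a[of b]
    by (simp add: precomp_def alpha_to_one_def sign_vec_def line_vec_def del: One_nat_def)
  have base: "k\<^sub>1 (\<lambda>s\<in>?S. gbase F) = gbase X"
    using pointed_ghomeo_base[OF k\<^sub>1] by (simp add: gbase_loops)
  have neg: "?c ?m' (Some (sign_vec b)) = ?c m (Some (sign_vec (- ln (- b))))" if "b < 0" for b
    by (rule restrict_ext)
      (use that in \<open>auto simp: topspace_line sphere_smash_line_sign rot_sum_None rot_sum_1
        simp del: One_nat_def sphere_smash.simps(1)\<close>)
  have pos: "?c ?m' (Some (sign_vec b)) = gact (loops rep_one F) (?c m (Some (sign_vec (- ln b))))"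
    if "b > 0" for b
    unfolding gact_loops
    by (rule restrict_ext)
      (use that in \<open>auto simp: topspace_line sphere_smash_line_sign rot_sum_None rot_sum_1 m0 gact_base
        simp del: One_nat_def sphere_smash.simps(1)\<close>)
  have zero: "?c ?m' (Some (sign_vec 0)) = (\<lambda>s\<in>?S. gbase F)"
    by (rule restrict_ext)
      (auto simp: topspace_line sphere_smash_line_sign rot_sum_None rot_sum_1 m0
        simp del: One_nat_def sphere_smash.simps(1))
  have none: "?c f None = (\<lambda>s\<in>?S. f None)" for f :: "vec option \<Rightarrow> 'a" by simp
  have fc: "None \<in> topspace (gtop free_circle)" "Some (g, line_vec u) \<in> topspace (gtop free_circle)" for g u
    by (auto simp: free_circle_def topspace_Euclidean_space line_vec_def coord0_def)
  have q: "q = ?n ?m'"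
    unfolding q_def precomp_def
  proof (rule restrict_ext)
    fix v assume "v \<in> ?A"
    then consider "v = None" | b where "v = Some (sign_vec b)" "b < 0"
      | b where "v = Some (sign_vec b)" "b > 0" | "v = Some (sign_vec 0)"
      unfolding topspace_sign by (auto simp: linorder_neq_iff) (metis linorder_neq_iff)
    then show "(loop_pair l (gact (loops rep_one X) l) \<circ> pinch) v = k\<^sub>1 (?c ?m' v)"
    proof cases
      case 1
      then show ?thesis unfolding none rot_sum_None m0 base
        using fc by (simp add: pinch_def loop_pair_def l0 m0 base rot_sum_None del: One_nat_def)
    next
      case 2
      have "pinch v = Some (False, line_vec (- ln (- b)))"
        using 2 by (simp add: pinch_def sign_vec_def line_vec_def)
      then show ?thesis using fc 2 by (simp add: loop_pair_def lb neg del: One_nat_def)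
    next
      case 3
      \<comment> \<open>The copy of the circle indexed by the generator is traversed backwards; its
        parameter \<open>- ln b\<close> is the one found in \<open>rot_sum_1\<close>.\<close>
      have "pinch v = Some (True, line_vec (- ln b))"
        using 3 by (simp add: pinch_def sign_vec_def line_vec_def)
      then have "(loop_pair l (gact (loops rep_one X) l) \<circ> pinch) v = gact X (l (Some (line_vec (- ln b))))"
        using fc s by (simp add: loop_pair_def gact_loops del: One_nat_def)
      also have "\<dots> = k\<^sub>1 (?c ?m' v)"
        using pointed_ghomeo_gact[OF k\<^sub>1 c[OF a]] 3 by (simp only: lb pos)
      finally show ?thesis .
    next
      case 4
      then show ?thesis unfolding 4 zero base
        using fc by (simp add: pinch_def loop_pair_def sign_vec_def l0 del: One_nat_def)
    qed
  qed
  then show "q \<in> topspace (gtop (loops rep_alpha X))" using n by simp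
  show "s\<^sub>\<alpha> q = K ?m'" using q K_alpha_one[OF m'] by simp
qed

end

text \<open>This keeps the homotopy pointed at every time.\<close>

lemma rot_sum_base:
  assumes "\<sigma> b = b"
  shows "rot_sum \<sigma> t (\<lambda>_\<in>topspace (gtop (rep_sphere (1, 1))). b) =
    (\<lambda>_\<in>topspace (gtop (rep_sphere (1, 1))). b)"
  unfolding rot_sum_def
proof (rule restrict_ext)
  let ?S = "topspace (gtop (rep_sphere (1, 1)))"
  fix v assume "v \<in> ?S"
  then have "half_collapse t v \<in> ?S" "half_collapse' t v \<in> ?S"
    unfolding topspace_plane by auto
  then show "(if half_collapse' t v = None then (\<lambda>_\<in>?S. b) (half_collapse t v)
      else \<sigma> ((\<lambda>_\<in>?S. b) (half_collapse' t v))) = b"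
    using assms by simp
qed

section \<open>Exchanging the trivial and the sign direction\<close>

lemma continuous_map_precomp:
  assumes A: "compact_space (gtop A)" "Hausdorff_space (gtop A)"
    and p: "continuous_map (gtop B) (gtop A) p" "p (gbase B) = gbase A"
    and B: "gbase B \<in> topspace (gtop B)"
  shows "continuous_map (gtop (gmap A X)) (gtop (gmap B X)) (precomp B p)"
proof (rule continuous_map_into_gmap)
  let ?Z = "prod_topology (gtop (gmap A X)) (gtop B)"
  have "continuous_map ?Z (gtop A) (\<lambda>z. p (snd z))"
    using continuous_map_compose[OF continuous_map_snd p(1)] by (simp add: o_def)
  from continuous_map_gmap_eval[OF A continuous_map_fst this]
  show "continuous_map ?Z (gtop X) (\<lambda>(f, b). f (p b))" by (simp add: case_prod_unfold)
qed (use p B in \<open>auto simp: precomp_def topspace_gmap\<close>)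

lemma alpha_to_one_simps [simp]:
  "alpha_to_one None = None"
  "alpha_to_one (Some (line_vec t)) = Some (sign_vec t)"
  "alpha_to_one (Some (sign_vec t)) = Some (line_vec t)"
  by (simp_all add: alpha_to_one_def line_vec_def sign_vec_def)

lemma continuous_map_alpha_to_one:
  "continuous_map (gtop (rep_sphere rep_alpha)) (gtop (rep_sphere rep_one)) alpha_to_one"
  "continuous_map (gtop (rep_sphere rep_one)) (gtop (rep_sphere rep_alpha)) alpha_to_one"
  by (rule continuous_map_sphere_homeo[OF sphere_chart_sign sphere_chart_line, where \<phi> = "\<lambda>t. t" and \<psi> = "\<lambda>t. t"];
      simp)
    (rule continuous_map_sphere_homeo[OF sphere_chart_line sphere_chart_sign, where \<phi> = "\<lambda>t. t" and \<psi> = "\<lambda>t. t"];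
      simp)

lemma precomp_alpha_to_one:
  "continuous_map (gtop (loops rep_one X)) (gtop (loops rep_alpha X)) (precomp (rep_sphere rep_alpha) alpha_to_one)"
  "continuous_map (gtop (loops rep_alpha X)) (gtop (loops rep_one X)) (precomp (rep_sphere rep_one) alpha_to_one)"
  unfolding loops_def
  by (intro continuous_map_precomp continuous_map_alpha_to_one compact_space_sphere[OF sphere_chart_line]
      Hausdorff_space_sphere[OF sphere_chart_line] compact_space_sphere[OF sphere_chart_sign]
      Hausdorff_space_sphere[OF sphere_chart_sign];
      simp add: topspace_line topspace_sign del: One_nat_def)+

lemma precomp_alpha_to_one_twice:
  assumes "f \<in> extensional (topspace (gtop (rep_sphere rep_one)))"
  shows "precomp (rep_sphere rep_one) alpha_to_one (precomp (rep_sphere rep_alpha) alpha_to_one f) = f"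
  unfolding precomp_def
proof (rule extensionalityI[OF restrict_extensional assms])
  fix s assume "s \<in> topspace (gtop (rep_sphere rep_one))"
  then consider "s = None" | t where "s = Some (line_vec t)" unfolding topspace_line by auto
  then show "restrict (restrict (f \<circ> alpha_to_one) (topspace (gtop (rep_sphere rep_alpha))) \<circ> alpha_to_one)
      (topspace (gtop (rep_sphere rep_one))) s = f s"
    by cases (simp_all add: topspace_line topspace_sign del: One_nat_def)
qed

lemma loop_reverse_in:
  assumes "f \<in> topspace (gtop (loops rep_one X))"
  shows "loop_reverse f \<in> topspace (gtop (loops rep_one X))"
proof -
  let ?S = "gtop (rep_sphere rep_one)"
  let ?r = "\<lambda>s. case s of None \<Rightarrow> None | Some v \<Rightarrow> line_pt (- fst v 0)"
  have "continuous_map ?S ?S ?r"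
    by (rule continuous_map_sphere_homeo[OF sphere_chart_line sphere_chart_line,
          where \<phi> = uminus and \<psi> = uminus])
      (auto simp: line_pt_eq fst_line_vec intro!: continuous_intros)
  then have "continuous_map ?S (gtop X) (f \<circ> ?r)"
    using assms by (auto simp: topspace_loops intro: continuous_map_compose)
  then have "continuous_map ?S (gtop X) (loop_reverse f)"
    by (rule continuous_map_eq) (auto simp: loop_reverse_def split: option.split)
  then show ?thesis
    using assms by (simp add: topspace_loops) (simp add: loop_reverse_def)
qed

text \<open>Both sides parametrize the half-lines by logarithms: on the positive one
  \<open>pinch\<close> reads \<open>y\<close> at \<open>- ln b\<close>, which is
  \<open>loop_reverse y\<close> at \<open>ln b\<close>. No reparametrization is left over.\<close>

lemma pinch_eq_diff:
  assumes x: "x None = y None"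
  shows "precomp (rep_sphere rep_alpha) pinch (loop_pair x y) =
    precomp (rep_sphere rep_alpha) alpha_to_one (loop_concat x (loop_reverse y))"
  unfolding precomp_def
proof (rule restrict_ext)
  have fc: "None \<in> topspace (gtop free_circle)" "Some (g, line_vec u) \<in> topspace (gtop free_circle)" for g u
    by (auto simp: free_circle_def topspace_Euclidean_space line_vec_def coord0_def)
  have s: "None \<in> topspace (gtop (rep_sphere rep_one))"
    "Some (line_vec b) \<in> topspace (gtop (rep_sphere rep_one))" for b
    by (simp_all add: topspace_line del: One_nat_def)
  fix v assume "v \<in> topspace (gtop (rep_sphere rep_alpha))"
  then consider "v = None" | b where "v = Some (sign_vec b)"
    unfolding topspace_sign by auto
  then show "(loop_pair x y \<circ> pinch) v = (loop_concat x (loop_reverse y) \<circ> alpha_to_one) v"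
  proof cases
    case 1
    then show ?thesis using fc s by (simp add: pinch_def loop_pair_def)
  next
    case 2
    have "pinch v = (if b = 0 then None else Some (b > 0, line_vec (- ln \<bar>b\<bar>)))"
      using 2 by (simp add: pinch_def sign_vec_def line_vec_def)
    then show ?thesis
      using fc s 2 x by (auto simp: loop_pair_def simp del: One_nat_def)
  qed
qed

section \<open>The boundary map without homotopy fixed points\<close>

lemma coord0_1_in_EZ2: "coord0 1 \<in> topspace EZ2"
proof -
  have "openin EZ2 (\<Union>n. topspace (nsphere n))"
    unfolding openin_EZ2 by (metis Int_commute Int_absorb1 UN_upper UNIV_I openin_topspace subset_refl)
  moreover have "coord0 1 \<in> topspace (nsphere 0)"
    by (simp add: nsphere coord0_def)
  ultimately show ?thesis using openin_subset by blast
qed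

text \<open>The connecting map takes values in constant functions on \<open>EZ2\<close>, coming from
  strict fixed points, so evaluating at \<open>coord0 1\<close> just recovers the constant.\<close>

lemma boundary_map_eq:
  "boundary_map E V x = (let l = deloop E rep_one (V - ro_of rep_one) x in
     strmap E rep_alpha (V - ro_of rep_alpha)
       (precomp (rep_sphere rep_alpha) pinch (loop_pair l (gact (loops rep_one (level E V)) l))))"
  by (simp add: boundary_map_def connecting_map_def hfix_incl_def hfix_map_def fix_to_hfix_def
      coord0_1_in_EZ2 Let_def)

section \<open>Double loop spaces from a real spectrum\<close>

lemma ro_of_rep_one_alpha:
  "ro_of rep_one + (V - ro_of rep_one) = V" "ro_of rep_alpha + (V - ro_of rep_alpha) = V"
  "ro_of rep_alpha + (ro_of rep_one + (V - ro_of rep_alpha)) = ro_of rep_one + V"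
  "ro_of (1, 1) + (V - ro_of rep_alpha) = ro_of rep_one + V"
  by (auto simp: ro_of_def prod_eq_iff)

text \<open>1 + \<alpha> and \<alpha> + 1 are the same pair \<open>(1, 1)\<close>, so compatibility,
  applied once for each order, factors one and the same structure map in two ways.\<close>

lemma real_spectrum_double_loops:
  assumes E: "real_spectrum E"
  shows "double_loops (level E (ro_of rep_one + V)) (level E V)
    (level E (ro_of rep_one + (V - ro_of rep_alpha))) (level E (V - ro_of rep_alpha))
    (strmap E rep_one V) (strmap E rep_alpha (ro_of rep_one + (V - ro_of rep_alpha)))
    (strmap E rep_one (V - ro_of rep_alpha)) (strmap E rep_alpha (V - ro_of rep_alpha))
    (strmap E (1, 1) (V - ro_of rep_alpha))"
proof -
  let ?B = "V - ro_of rep_alpha"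
  have pt: "pointed_gspace (level E W)" for W using E unfolding real_spectrum_def by blast
  have homeo: "pointed_ghomeo (loops U (level E (ro_of U + W))) (level E W) (strmap E U W)" for U W
    using E unfolding real_spectrum_def by blast
  have compat: "strmap E (U + U') W f = strmap E U W (\<lambda>s\<in>topspace (gtop (rep_sphere U)).
          strmap E U' (ro_of U + W) (\<lambda>s'\<in>topspace (gtop (rep_sphere U')). f (sphere_smash U s s')))"
    if "f \<in> topspace (gtop (loops (U + U') (level E (ro_of (U + U') + W))))" for U U' W f
    using E that unfolding real_spectrum_def by blast
  have sum: "rep_one + rep_alpha = (1, 1)" "rep_alpha + rep_one = (1, 1)"
    by (simp_all add: plus_prod_def)
  show ?thesis
  proof
    show "pointed_ghomeo (loops rep_alpha (level E (ro_of rep_one + V)))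
        (level E (ro_of rep_one + ?B)) (strmap E rep_alpha (ro_of rep_one + ?B))"
      using homeo[of rep_alpha "ro_of rep_one + ?B"] unfolding ro_of_rep_one_alpha .
    show "pointed_ghomeo (loops rep_alpha (level E V)) (level E ?B) (strmap E rep_alpha ?B)"
      using homeo[of rep_alpha ?B] unfolding ro_of_rep_one_alpha .
    show "pointed_ghomeo (loops (1, 1) (level E (ro_of rep_one + V))) (level E ?B) (strmap E (1, 1) ?B)"
      using homeo[of "(1, 1)" ?B] unfolding ro_of_rep_one_alpha .
    show "strmap E (1, 1) ?B m = strmap E rep_one ?B (\<lambda>s\<in>topspace (gtop (rep_sphere rep_one)).
        strmap E rep_alpha (ro_of rep_one + ?B) (\<lambda>a\<in>topspace (gtop (rep_sphere rep_alpha)).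
          m (sphere_smash rep_one s a)))"
      if "m \<in> topspace (gtop (loops (1, 1) (level E (ro_of rep_one + V))))" for m
      using compat[of m rep_one rep_alpha ?B] that unfolding sum ro_of_rep_one_alpha by blast
    show "strmap E (1, 1) ?B m = strmap E rep_alpha ?B (\<lambda>a\<in>topspace (gtop (rep_sphere rep_alpha)).
        strmap E rep_one V (\<lambda>s\<in>topspace (gtop (rep_sphere rep_one)).
          m (sphere_smash rep_alpha a s)))"
      if "m \<in> topspace (gtop (loops (1, 1) (level E (ro_of rep_one + V))))" for m
      using compat[of m rep_alpha rep_one ?B] that unfolding sum ro_of_rep_one_alpha by blast
  qed (rule pt homeo)+
qed

theorem proposition1p5:
  fixes E :: "'a rspec" and V :: "int \<times> int"
  assumes "real_spectrum E"
  shows "pointed_homotopic (level E (V - ro_of rep_one)) (level E (V - ro_of rep_alpha))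
           (boundary_map E V)
           (shift_ident E V \<circ>
              (\<lambda>x. spec_diff E (V - ro_of rep_one) x (gact (level E (V - ro_of rep_one)) x)))
       \<and> pointed_homotopic (level E (V - ro_of rep_one)) (level E (V - ro_of rep_alpha))
           (boundary_map E V)
           ((\<lambda>y. spec_add E (V - ro_of rep_alpha) y (gact (level E (V - ro_of rep_alpha)) y)) \<circ>
              shift_ident E V)"
proof -
  define A where "A = V - ro_of rep_one"
  define B where "B = V - ro_of rep_alpha"
  define F where "F = level E (ro_of rep_one + V)"
  define G where "G = level E (ro_of rep_one + B)"
  define K where "K = strmap E (1, 1) B"
  define inv_K where "inv_K = inv_into (topspace (gtop (loops (1, 1) F))) K"
  define s\<^sub>\<alpha> where "s\<^sub>\<alpha> = strmap E rep_alpha B"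
  define s\<^sub>1 where "s\<^sub>1 = strmap E rep_one A"
  define l where "l = deloop E rep_one A"
  let ?X = "level E V" and ?A = "level E A" and ?B = "level E B"
  let ?swap = "precomp (rep_sphere rep_alpha) alpha_to_one"
  interpret D: double_loops F ?X G ?B "strmap E rep_one V"
      "strmap E rep_alpha (ro_of rep_one + B)" "strmap E rep_one B" s\<^sub>\<alpha> K
    using real_spectrum_double_loops[OF assms, of V]
    unfolding F_def G_def s\<^sub>\<alpha>_def K_def B_def .
  have A1: "ro_of rep_one + A = V" unfolding A_def by (rule ro_of_rep_one_alpha)
  have s\<^sub>1: "pointed_ghomeo (loops rep_one ?X) ?A s\<^sub>1"
    using assms A1 unfolding s\<^sub>1_def real_spectrum_def by metis
  have pA: "pointed_gspace ?A" using assms unfolding real_spectrum_def by blast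
  have l_def': "l = inv_into (topspace (gtop (loops rep_one ?X))) s\<^sub>1"
    by (simp only: l_def deloop_def A1 s\<^sub>1_def)
  have shift: "shift_ident E V x = s\<^sub>\<alpha> (?swap (l x))" for x
    by (simp add: shift_ident_def s\<^sub>\<alpha>_def l_def A_def B_def)
  have l_in: "l x \<in> topspace (gtop (loops rep_one ?X))" if "x \<in> topspace (gtop ?A)" for x
    unfolding l_def' by (rule pointed_ghomeo_inv_in[OF s\<^sub>1 that])
  have swap_in: "?swap f \<in> topspace (gtop (loops rep_alpha ?X))"
    if "f \<in> topspace (gtop (loops rep_one ?X))" for f
    using continuous_map_image_subset_topspace[OF precomp_alpha_to_one(1)] that by blast
  have shift_cont: "continuous_map (gtop ?A) (gtop ?B) (shift_ident E V)"
  proof -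
    have "continuous_map (gtop ?A) (gtop ?B) (s\<^sub>\<alpha> \<circ> (?swap \<circ> l))"
      unfolding l_def'
      by (rule continuous_map_compose[OF continuous_map_compose[OF
            pointed_ghomeo_inv_continuous[OF s\<^sub>1] precomp_alpha_to_one(1)]
            pointed_ghomeo_continuous[OF D.s\<^sub>\<alpha>]])
    moreover have "s\<^sub>\<alpha> \<circ> (?swap \<circ> l) = shift_ident E V" by (simp only: fun_eq_iff o_apply shift simp_thms)
    ultimately show ?thesis by simp
  qed
  have shift_in: "shift_ident E V x \<in> topspace (gtop ?B)" if "x \<in> topspace (gtop ?A)" for x
    using continuous_map_image_subset_topspace[OF shift_cont] that by blast
  \<comment> \<open>The double loop of \<open>x\<close> is obtained by inverting \<open>K\<close> at
    once rather than by delooping twice: continuity is then immediate, and both iterated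
    descriptions follow from compatibility.\<close>
  define m where "m = inv_K \<circ> shift_ident E V"
  have m_in: "m x \<in> topspace (gtop (loops (1, 1) F))" and Km: "K (m x) = shift_ident E V x"
    if "x \<in> topspace (gtop ?A)" for x
    using pointed_ghomeo_inv_in[OF D.K shift_in[OF that]]
      pointed_ghomeo_inv_right[OF D.K shift_in[OF that]] by (simp_all add: m_def inv_K_def)
  have m_cont: "continuous_map (gtop ?A) (gtop (loops (1, 1) F)) m"
    unfolding m_def inv_K_def
    by (rule continuous_map_compose[OF shift_cont pointed_ghomeo_inv_continuous[OF D.K]])
  have boundary: "boundary_map E V x = s\<^sub>\<alpha> (precomp (rep_sphere rep_alpha) pinch
      (loop_pair (l x) (gact (loops rep_one ?X) (l x))))" for x
    by (simp add: boundary_map_eq Let_def s\<^sub>\<alpha>_def l_def A_def B_def)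
  have boundary_K: "boundary_map E V x = K (rot_sum (gact F) 1 (m x))"
    and pinch_in: "precomp (rep_sphere rep_alpha) pinch
      (loop_pair (l x) (gact (loops rep_one ?X) (l x))) \<in> topspace (gtop (loops rep_alpha ?X))"
    if x: "x \<in> topspace (gtop ?A)" for x
    using D.pinch_sum[OF m_in[OF x] l_in[OF x] swap_in[OF l_in[OF x]]] Km[OF x]
    by (simp_all add: boundary shift)
  \<comment> \<open>Time 0 is the sum in E_(V-\<alpha>), time 1 the boundary map.\<close>
  define H where "H = (\<lambda>(t, x). K (rot_sum (gact F) t (m x)))"
  have H: "continuous_map (prod_topology (top_of_set {0..1}) (gtop ?A)) (gtop ?B) H"
  proof -
    have "continuous_map (prod_topology (top_of_set {0..1}) (gtop ?A))
        (prod_topology (top_of_set {0..1::real}) (gtop (loops (1, 1) F))) (\<lambda>(t, x). (t, m x))"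
      by (simp only: continuous_map_prod_top continuous_map_id[unfolded id_def] m_cont simp_thms)
    from continuous_map_compose[OF continuous_map_compose[OF this continuous_map_rot_sum[OF D.F]]
        pointed_ghomeo_continuous[OF D.K]]
    show ?thesis by (simp add: H_def o_def case_prod_unfold)
  qed
  have bA: "gbase ?A \<in> topspace (gtop ?A)" using pA by (simp add: pointed_gspace_def)
  have m_base: "m (gbase ?A) = gbase (loops (1, 1) F)"
  proof -
    have base_in: "gbase (loops U Z) \<in> topspace (gtop (loops U Z))" if "pointed_gspace Z"
      for U and Z :: "'a gspace"
      using that by (auto simp: gbase_loops topspace_loops pointed_gspace_def rep_sphere_def
          intro!: continuous_map_eq[of _ _ "\<lambda>_. gbase Z"])
    have "l (gbase ?A) = gbase (loops rep_one ?X)"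
      using pointed_ghomeo_inv_left[OF s\<^sub>1 base_in[OF D.X]] pointed_ghomeo_base[OF s\<^sub>1]
      by (simp add: l_def')
    moreover have "?swap (gbase (loops rep_one ?X)) = gbase (loops rep_alpha ?X)"
      unfolding gbase_loops precomp_def
      by (rule restrict_ext) (auto simp: topspace_sign topspace_line simp del: One_nat_def)
    ultimately have "shift_ident E V (gbase ?A) = K (gbase (loops (1, 1) F))"
      by (simp only: shift pointed_ghomeo_base[OF D.s\<^sub>\<alpha>] pointed_ghomeo_base[OF D.K])
    then show ?thesis
      using pointed_ghomeo_inv_left[OF D.K base_in[OF D.F]] by (simp only: m_def inv_K_def o_apply)
  qed
  have H_base: "H (t, gbase ?A) = gbase ?B" for t
  proof -
    have "rot_sum (gact F) t (gbase (loops (1, 1) F)) = gbase (loops (1, 1) F)"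
      unfolding gbase_loops by (rule rot_sum_base) (rule D.gact_base)
    then show ?thesis by (simp only: H_def m_base pointed_ghomeo_base[OF D.K] prod.case)
  qed
  have sum: "spec_add E B (shift_ident E V x) (gact ?B (shift_ident E V x)) = H (0, x)"
    if "x \<in> topspace (gtop ?A)" for x
    using D.one_sum[OF m_in[OF that]] Km[OF that]
    by (simp add: H_def spec_add_def deloop_def G_def)
  have H1: "H (1, x) = boundary_map E V x" if "x \<in> topspace (gtop ?A)" for x
    using boundary_K[OF that] by (simp add: H_def)
  have diff: "shift_ident E V (spec_diff E A x (gact ?A x)) = boundary_map E V x"
    if x: "x \<in> topspace (gtop ?A)" for x
  proof -
    let ?g = "gact (loops rep_one ?X) (l x)"
    let ?c = "loop_concat (l x) (loop_reverse ?g)"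
    have g: "?g \<in> topspace (gtop (loops rep_one ?X))" by (rule gact_loops_one_in[OF D.X l_in[OF x]])
    have lg: "l (gact ?A x) = ?g"
      unfolding l_def' by (rule pointed_ghomeo_deloop_gact[OF s\<^sub>1 D.X x])
    have l_s: "l (s\<^sub>1 f) = f" if "f \<in> topspace (gtop (loops rep_one ?X))" for f
      unfolding l_def' by (rule pointed_ghomeo_inv_left[OF s\<^sub>1 that])
    have pinch: "precomp (rep_sphere rep_alpha) pinch (loop_pair (l x) ?g) = ?swap ?c"
      using l_in[OF x] g by (intro pinch_eq_diff) (simp add: topspace_loops)
    \<comment> \<open>That the concatenation is a continuous loop comes for free: exchanged into the
      sign direction it is the pinched loop, already known to lie in the loop space, and the
      exchange can be undone.\<close>
    have "precomp (rep_sphere rep_one) alpha_to_one (?swap ?c) \<in> topspace (gtop (loops rep_one ?X))"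
      using continuous_map_image_subset_topspace[OF precomp_alpha_to_one(2)] pinch_in[OF x]
      unfolding pinch by blast
    moreover have "precomp (rep_sphere rep_one) alpha_to_one (?swap ?c) = ?c"
      by (rule precomp_alpha_to_one_twice[OF loop_concat_extensional])
    ultimately have c: "?c \<in> topspace (gtop (loops rep_one ?X))" by simp
    have "spec_diff E A x (gact ?A x) = s\<^sub>1 ?c"
      using lg l_s[OF loop_reverse_in[OF g]]
      by (simp add: spec_diff_def spec_add_def spec_neg_def l_def s\<^sub>1_def)
    then show ?thesis using l_s[OF c] pinch by (simp add: shift boundary)
  qed
  have "homotopic_with (\<lambda>h. h (gbase ?A) = gbase ?B) (gtop ?A) (gtop ?B) (\<lambda>x. H (0, x)) (\<lambda>x. H (1, x))"
    unfolding homotopic_with_def using H H_base by blast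
  then have hom: "homotopic_with (\<lambda>h. h (gbase ?A) = gbase ?B) (gtop ?A) (gtop ?B)
      (\<lambda>x. H (1, x)) (\<lambda>x. H (0, x))"
    by (rule homotopic_with_symD)
  have cont: "continuous_map (gtop ?A) (gtop ?B) (\<lambda>x. H (1, x))" "continuous_map (gtop ?A) (gtop ?B) (\<lambda>x. H (0, x))"
    using homotopic_with_imp_continuous_maps[OF hom] by auto
  have "pointed_homotopic ?A ?B (boundary_map E V) (shift_ident E V \<circ> (\<lambda>x. spec_diff E A x (gact ?A x)))"
    unfolding pointed_homotopic_def
  \<comment> \<open>A constant homotopy suffices, and the continuity of the boundary map is read off
    from the end of \<open>H\<close>.\<close>
  proof (rule homotopic_with_equal)
    show "continuous_map (gtop ?A) (gtop ?B) (boundary_map E V)"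
      by (rule continuous_map_eq[OF cont(1) H1])
    show "boundary_map E V (gbase ?A) = gbase ?B"
      using H1[OF bA] H_base[of 1] by simp
    then show "(shift_ident E V \<circ> (\<lambda>x. spec_diff E A x (gact ?A x))) (gbase ?A) = gbase ?B"
      using diff[OF bA] by simp
  qed (simp add: diff)
  moreover have "pointed_homotopic ?A ?B (boundary_map E V)
      ((\<lambda>y. spec_add E B y (gact ?B y)) \<circ> shift_ident E V)"
    unfolding pointed_homotopic_def
  proof (rule homotopic_with_eq[OF hom])
    \<comment> \<open>\<open>H\<close> agrees with the two maps only on the space itself, so being
      pointed must depend only on values there; the base point does lie in it.\<close>
    fix h k :: "'a \<Rightarrow> 'a" assume "\<And>x. x \<in> topspace (gtop ?A) \<Longrightarrow> h x = k x"
    then show "(h (gbase ?A) = gbase ?B) = (k (gbase ?A) = gbase ?B)" using bA by simp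
  qed (simp_all add: H1 sum)
  ultimately show ?thesis unfolding A_def B_def ..
qed

end
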